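(* Let $\omega$ be a weight satisfying the regularity condition $S$. Then the following are equivalent. (1) ($\omega\in\bigcup_{p>1}A_p$) There exist $C,p>1$ such that for all $n\in\mathbb{N}$, $\mathbb{E}(\omega|\mathcal{F}_n)\,\mathbb{E}(\omega^{-\frac{1}{p-1}}|\mathcal{F}_n)^{p-1}\le C$. (2) ($\omega\in A_\infty^{exp}$) There exists a positive constant $C$ such that for all $n\in\mathbb{N}$, $\mathbb{E}(\omega|\mathcal{F}_n)\le C\exp\mathbb{E}(\log\omega|\mathcal{F}_n)$. (3) ($\omega\in A_\infty^{con}$) There exist $0<\gamma,\delta<1$ such that for all $n\in\mathbb{N}$, $\mathbb{E}(\chi_{\{\omega\le\gamma\omega_n\}}|\mathcal{F}_n)\le\delta<1$. (4) ($\omega\in A_\infty^{M}$) There exist $0<\alpha,\beta<1$ such that for all $n\in\mathbb{N}$ and $A\in\mathcal{F}$: $\mathbb{E}(\chi_A|\mathcal{F}_n)\le\alpha<1\Rightarrow\mathbb{E}_\omega(\chi_A|\mathcal{F}_n)\le\beta<1$. (5) ($\omega\in\bigcup_{q>1}RH_q$) There exist $C,q>1$ such that for all $n\in\mathbb{N}$, $\mathbb{E}(\omega^q|\mathcal{F}_n)\le C\,\mathbb{E}(\omega|\mathcal{F}_n)^q$. (6) ($\omega\in A_\infty^{CF}$) There exist $0<\varepsilon'<1$ and $C>1$ such that for all $n\in\mathbb{N}$ and $A\in\mathcal{F}$, $\mathbb{E}_\omega(\chi_A|\mathcal{F}_n)\le C\,\mathbb{E}(\chi_A|\mathcal{F}_n)^{\varepsilon'}$.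 (7) ($\omega\in\hat{A}_\infty^{M}$) There exist $0<\alpha,\beta<1$ such that for all $n\in\mathbb{N}$ and $A\in\mathcal{F}$: $\mathbb{E}_\omega(\chi_A|\mathcal{F}_n)\le\alpha<1\Rightarrow\mathbb{E}(\chi_A|\mathcal{F}_n)\le\beta<1$.
   Context: $(\Omega,\mathcal{F},\mu)$ is a complete probability space and $(\mathcal{F}_n)_{n\ge0}$ is an increasing sequence of sub-$\sigma$-fields of $\mathcal{F}$ with $\mathcal{F}=\bigvee_{n\ge0}\mathcal{F}_n$. $\mathbb{N}$ is the set of non-negative integers. $\mathbb{E}(\cdot|\mathcal{F}_n)$ is conditional expectation with respect to $\mu$ (of nonnegative functions it may take the value $+\infty$). Relations between random variables hold almost surely. A weight $\omega$ is a random variable with $\omega>0$ and $\mathbb{E}(\omega)<\infty$; $\omega_n:=\mathbb{E}(\omega|\mathcal{F}_n)$. $\mathbb{E}_\omega(\cdot|\mathcal{F}_n)$ is the conditional expectation with respect to $\omega\,d\mu$, i.e. $\mathbb{E}_\omega(f|\mathcal{F}_n)=\mathbb{E}(f\omega|\mathcal{F}_n)/\omega_n$. $\chi_A$ is the indicator function of $A$. The conditional expectation $\mathbb{E}(\log\omega|\mathcal{F}_n)$ takes values in $[-\infty,\infty)$, with $\exp(-\infty)=0$. A weight $\omega$ satisfies the regularity condition $S$ ($\omega\in S$) if there is $C>1$ such that $\frac1C\omega_{n-1}\le\omega_n\le C\omega_{n-1}$ for all $n\ge1$. *)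

theory Defs
  imports "HOL-Probability.Probability"
begin

section \<open>Extended-valued functions and conditional expectations\<close>

definition exp_ereal :: "ereal \<Rightarrow> ennreal" where
  "exp_ereal y = (case y of ereal r \<Rightarrow> ennreal (exp r) | PInfty \<Rightarrow> top | MInfty \<Rightarrow> 0)"

text \<open>Only meant for exponents \<open>a > 0\<close>, where \<open>0\<close> is sent to \<open>0\<close> and \<open>\<infinity>\<close> to \<open>\<infinity>\<close>.\<close>

definition powr_ennreal :: "ennreal \<Rightarrow> real \<Rightarrow> ennreal" where
  "powr_ennreal y a = (if y = top then top else ennreal (enn2real y powr a))"

text \<open>
  Conditional expectation of a function whose positive part is integrable but whose negative
  part need not be: the value is \<open>-\<infinity>\<close> where the negative part has infinite conditional
  expectation.  (\<^const>\<open>real_cond_exp\<close> is real-valued and cannot express this.)  Recall that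
  \<^const>\<open>ennreal\<close> truncates negative numbers to \<open>0\<close>, so the two terms are the positive and the
  negative part.
\<close>

definition ereal_cond_exp :: "'a measure \<Rightarrow> 'a measure \<Rightarrow> ('a \<Rightarrow> real) \<Rightarrow> 'a \<Rightarrow> ereal" where
  "ereal_cond_exp M G f x =
     enn2ereal (nn_cond_exp M G (\<lambda>y. ennreal (f y)) x)
     - enn2ereal (nn_cond_exp M G (\<lambda>y. ennreal (- f y)) x)"


section \<open>Weights\<close>

text \<open>Random variables are identified when they agree almost surely, so positivity of a weight
  is required almost everywhere.\<close>

definition weight :: "'a measure \<Rightarrow> ('a \<Rightarrow> real) \<Rightarrow> bool" where
  "weight M \<omega> \<longleftrightarrow> \<omega> \<in> borel_measurable M \<and> (AE x in M. 0 < \<omega> x) \<and> integrable M \<omega>"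

definition weight_cond :: "'a measure \<Rightarrow> 'a measure \<Rightarrow> ('a \<Rightarrow> real) \<Rightarrow> 'a \<Rightarrow> ennreal" where
  "weight_cond M G \<omega> = nn_cond_exp M G (\<lambda>x. ennreal (\<omega> x))"

text \<open>Conditional expectation with respect to \<open>\<omega> d\<mu>\<close> (a finite, not necessarily normalised,
  measure); the quotient formula is \<open>weighted_cond_exp_eq\<close> below.\<close>

definition weighted_cond_exp ::
    "'a measure \<Rightarrow> ('a \<Rightarrow> real) \<Rightarrow> 'a measure \<Rightarrow> ('a \<Rightarrow> ennreal) \<Rightarrow> 'a \<Rightarrow> ennreal" where
  "weighted_cond_exp M \<omega> G f = nn_cond_exp (density M (\<lambda>x. ennreal (\<omega> x))) G f"

lemma weighted_cond_exp_eq: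
  assumes "prob_space M" "subalgebra M G" "weight M \<omega>" and f[measurable]: "f \<in> borel_measurable M"
  shows "AE x in M. weighted_cond_exp M \<omega> G f x =
           nn_cond_exp M G (\<lambda>x. f x * ennreal (\<omega> x)) x / weight_cond M G \<omega> x"
proof -
  interpret prob_space M by fact
  interpret finite_measure_subalgebra M G
    using assms(2) by unfold_locales
  let ?D = "density M (\<lambda>x. ennreal (\<omega> x))"
  have [measurable]: "\<omega> \<in> borel_measurable M" and pos: "AE x in M. 0 < \<omega> x"
    and int: "integrable M \<omega>"
    using assms(3) by (auto simp: weight_def)
  define W where "W = weight_cond M G \<omega>"
  define N where "N = nn_cond_exp M G (\<lambda>x. f x * ennreal (\<omega> x))"
  have WG[measurable]: "W \<in> borel_measurable G" and NG[measurable]: "N \<in> borel_measurable G"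
    by (simp_all add: W_def N_def weight_cond_def)
  have [measurable]: "W \<in> borel_measurable M" "N \<in> borel_measurable M"
    by (simp_all add: W_def N_def weight_cond_def)
  have intM: "(\<integral>\<^sup>+ x. g x * W x \<partial>M) = (\<integral>\<^sup>+ x. g x * ennreal (\<omega> x) \<partial>M)"
    if "g \<in> borel_measurable G" for g
    unfolding W_def weight_cond_def by (rule nn_cond_exp_intg) (use that in auto)
  have intN: "(\<integral>\<^sup>+ x. g x * N x \<partial>M) = (\<integral>\<^sup>+ x. g x * (f x * ennreal (\<omega> x)) \<partial>M)"
    if "g \<in> borel_measurable G" for g
    unfolding N_def by (rule nn_cond_exp_intg) (use that in auto)
  have fin: "(\<integral>\<^sup>+ x. ennreal (\<omega> x) \<partial>M) \<noteq> \<infinity>"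
  proof -
    have "(\<integral>\<^sup>+ x. ennreal (\<omega> x) \<partial>M) = (\<integral>\<^sup>+ x. ennreal (norm (\<omega> x)) \<partial>M)"
      by (rule nn_integral_cong_AE) (use pos in auto)
    then show ?thesis using int by (simp add: integrable_iff_bounded)
  qed
  have Wfin: "AE x in M. W x \<noteq> \<infinity>"
    by (rule nn_integral_noteq_infinite) (use intM[of "\<lambda>_. 1"] fin in auto)
  have Wpos: "AE x in M. W x \<noteq> 0"
  proof -
    define g :: "'a \<Rightarrow> ennreal" where "g x = indicator {x \<in> space G. W x = 0} x" for x
    have gm: "g \<in> borel_measurable G" unfolding g_def by measurable
    then have [measurable]: "g \<in> borel_measurable M"
      using measurable_from_subalg[OF assms(2)] by blast
    have "(\<integral>\<^sup>+ x. g x * ennreal (\<omega> x) \<partial>M) = (\<integral>\<^sup>+ x. g x * W x \<partial>M)"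
      using intM[OF gm] by simp
    also have "\<dots> = (\<integral>\<^sup>+ x. 0 \<partial>M)"
      by (rule nn_integral_cong) (auto simp: g_def indicator_def)
    finally have "(\<integral>\<^sup>+ x. g x * ennreal (\<omega> x) \<partial>M) = 0" by simp
    then have "AE x in M. g x * ennreal (\<omega> x) = 0"
      by (subst (asm) nn_integral_0_iff_AE) auto
    with pos AE_space show ?thesis
    proof eventually_elim
      case (elim x)
      then have "g x = 0" by (auto simp: ennreal_eq_0_iff)
      moreover have "x \<in> space G" using elim assms(2) by (simp add: subalgebra_def)
      ultimately show ?case by (auto simp: g_def)
    qed
  qed
  have subD: "subalgebra ?D G" using assms(2) by (simp add: subalgebra_def)
  have "finite_measure ?D"
    by (rule finite_measureI) (use fin in \<open>simp add: emeasure_density cong: nn_integral_cong\<close>)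
  then interpret D: finite_measure_subalgebra ?D G
    using subD by (simp add: finite_measure_subalgebra_def finite_measure_subalgebra_axioms_def)
  have "AE x in ?D. N x / W x = nn_cond_exp ?D G f x"
  proof (rule D.nn_cond_exp_charact)
    fix A assume A: "A \<in> sets G"
    then have [measurable]: "A \<in> sets M" using assms(2) by (auto simp: subalgebra_def)
    have gG: "(\<lambda>x. indicator A x * (N x / W x)) \<in> borel_measurable G"
      and iG: "(indicator A :: 'a \<Rightarrow> ennreal) \<in> borel_measurable G"
      using A by measurable
    have "(\<integral>\<^sup>+ x \<in> A. N x / W x \<partial>?D) = (\<integral>\<^sup>+ x. indicator A x * (N x / W x) * ennreal (\<omega> x) \<partial>M)"
      by (subst nn_integral_density) (auto simp: ac_simps intro!: nn_integral_cong)
    also have "\<dots> = (\<integral>\<^sup>+ x. indicator A x * (N x / W x) * W x \<partial>M)"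
      using intM[OF gG] by simp
    also have "\<dots> = (\<integral>\<^sup>+ x. indicator A x * N x \<partial>M)"
    proof (rule nn_integral_cong_AE)
      show "AE x in M. indicator A x * (N x / W x) * W x = indicator A x * N x"
        using Wfin Wpos
        by eventually_elim (simp add: mult.assoc ennreal_divide_times ennreal_times_divide
            ennreal_mult_divide_eq mult_divide_eq_ennreal less_top)
    qed
    also have "\<dots> = (\<integral>\<^sup>+ x. indicator A x * (f x * ennreal (\<omega> x)) \<partial>M)"
      by (rule intN[OF iG])
    also have "\<dots> = (\<integral>\<^sup>+ x \<in> A. f x \<partial>?D)"
      by (subst nn_integral_density) (auto simp: ac_simps intro!: nn_integral_cong)
    finally show "(\<integral>\<^sup>+ x \<in> A. f x \<partial>?D) = (\<integral>\<^sup>+ x \<in> A. N x / W x \<partial>?D)" by simp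
  qed auto
  then have "AE x in M. 0 < ennreal (\<omega> x) \<longrightarrow> N x / W x = nn_cond_exp ?D G f x"
    by (subst (asm) AE_density) auto
  with pos show ?thesis
    unfolding weighted_cond_exp_def N_def[symmetric] W_def[symmetric]
    by eventually_elim (auto simp: ennreal_less_zero_iff)
qed

section \<open>The conditions\<close>

text \<open>In the following definitions \<open>F\<close> is the filtration, every (in)equality between random
  variables is meant almost surely, and so an implication between two such inequalities is an
  implication between two almost sure statements.\<close>

definition regular_S :: "'a measure \<Rightarrow> (nat \<Rightarrow> 'a measure) \<Rightarrow> ('a \<Rightarrow> real) \<Rightarrow> bool" where
  "regular_S M F \<omega> \<longleftrightarrow>
     (\<exists>C>1::real. \<forall>n\<ge>1. AE x in M.
        ennreal (1 / C) * weight_cond M (F (n - 1)) \<omega> x \<le> weight_cond M (F n) \<omega> x \<and>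
        weight_cond M (F n) \<omega> x \<le> ennreal C * weight_cond M (F (n - 1)) \<omega> x)"

definition A_class :: "real \<Rightarrow> 'a measure \<Rightarrow> (nat \<Rightarrow> 'a measure) \<Rightarrow> ('a \<Rightarrow> real) \<Rightarrow> bool" where
  "A_class p M F \<omega> \<longleftrightarrow>
     (\<exists>C>1::real. \<forall>n. AE x in M.
        weight_cond M (F n) \<omega> x *
          powr_ennreal (nn_cond_exp M (F n) (\<lambda>y. ennreal (\<omega> y powr (- 1 / (p - 1)))) x) (p - 1)
        \<le> ennreal C)"

definition A_inf_exp :: "'a measure \<Rightarrow> (nat \<Rightarrow> 'a measure) \<Rightarrow> ('a \<Rightarrow> real) \<Rightarrow> bool" where
  "A_inf_exp M F \<omega> \<longleftrightarrow>
     (\<exists>C>0::real. \<forall>n. AE x in M.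
        weight_cond M (F n) \<omega> x
        \<le> ennreal C * exp_ereal (ereal_cond_exp M (F n) (\<lambda>y. ln (\<omega> y)) x))"

definition A_inf_con :: "'a measure \<Rightarrow> (nat \<Rightarrow> 'a measure) \<Rightarrow> ('a \<Rightarrow> real) \<Rightarrow> bool" where
  "A_inf_con M F \<omega> \<longleftrightarrow>
     (\<exists>\<gamma> \<delta> :: real. 0 < \<gamma> \<and> \<gamma> < 1 \<and> 0 < \<delta> \<and> \<delta> < 1 \<and>
        (\<forall>n. AE x in M.
           nn_cond_exp M (F n)
             (indicator {y \<in> space M. ennreal (\<omega> y) \<le> ennreal \<gamma> * weight_cond M (F n) \<omega> y}) x
           \<le> ennreal \<delta>))"

definition A_inf_M :: "'a measure \<Rightarrow> (nat \<Rightarrow> 'a measure) \<Rightarrow> ('a \<Rightarrow> real) \<Rightarrow> bool" where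
  "A_inf_M M F \<omega> \<longleftrightarrow>
     (\<exists>\<alpha> \<beta> :: real. 0 < \<alpha> \<and> \<alpha> < 1 \<and> 0 < \<beta> \<and> \<beta> < 1 \<and>
        (\<forall>n. \<forall>A\<in>sets M.
           (AE x in M. nn_cond_exp M (F n) (indicator A) x \<le> ennreal \<alpha>) \<longrightarrow>
           (AE x in M. weighted_cond_exp M \<omega> (F n) (indicator A) x \<le> ennreal \<beta>)))"

definition RH_class :: "real \<Rightarrow> 'a measure \<Rightarrow> (nat \<Rightarrow> 'a measure) \<Rightarrow> ('a \<Rightarrow> real) \<Rightarrow> bool" where
  "RH_class q M F \<omega> \<longleftrightarrow>
     (\<exists>C>1::real. \<forall>n. AE x in M.
        nn_cond_exp M (F n) (\<lambda>y. ennreal (\<omega> y powr q)) x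
        \<le> ennreal C * powr_ennreal (weight_cond M (F n) \<omega> x) q)"

definition A_inf_CF :: "'a measure \<Rightarrow> (nat \<Rightarrow> 'a measure) \<Rightarrow> ('a \<Rightarrow> real) \<Rightarrow> bool" where
  "A_inf_CF M F \<omega> \<longleftrightarrow>
     (\<exists>\<epsilon> C :: real. 0 < \<epsilon> \<and> \<epsilon> < 1 \<and> 1 < C \<and>
        (\<forall>n. \<forall>A\<in>sets M. AE x in M.
           weighted_cond_exp M \<omega> (F n) (indicator A) x
           \<le> ennreal C * powr_ennreal (nn_cond_exp M (F n) (indicator A) x) \<epsilon>))"

definition A_inf_M_hat :: "'a measure \<Rightarrow> (nat \<Rightarrow> 'a measure) \<Rightarrow> ('a \<Rightarrow> real) \<Rightarrow> bool" where
  "A_inf_M_hat M F \<omega> \<longleftrightarrow>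
     (\<exists>\<alpha> \<beta> :: real. 0 < \<alpha> \<and> \<alpha> < 1 \<and> 0 < \<beta> \<and> \<beta> < 1 \<and>
        (\<forall>n. \<forall>A\<in>sets M.
           (AE x in M. weighted_cond_exp M \<omega> (F n) (indicator A) x \<le> ennreal \<alpha>) \<longrightarrow>
           (AE x in M. nn_cond_exp M (F n) (indicator A) x \<le> ennreal \<beta>)))"

end

theory Submission
  imports Defs
begin

text \<open>
  Write \<open>E\<close> for conditional expectation with respect to \<open>F n\<close>, \<open>W n\<close> for \<open>E \<omega>\<close>, and \<open>\<nu>\<close> for the
  measure \<open>\<omega> d\<mu>\<close>. The conditions are proved equivalent by going once around the cycle
  \<open>A_p \<Rightarrow> exp \<Rightarrow> con \<Rightarrow> M \<Rightarrow> RH_q \<Rightarrow> CF \<Rightarrow> M_hat \<Rightarrow> A_p\<close>.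

  Five of the seven steps concern one \<open>\<sigma>\<close>-algebra at a time. Each of the first, second, third and
  fifth consists in conditioning a pointwise inequality:
  the tangent line of \<open>exp\<close> (\<open>exp_bound_if_A_bound\<close>), the bound \<open>ln r \<le> r\<close> (\<open>con_bound_if_exp_bound\<close>),
  the definition of \<open>{\<omega> \<le> \<gamma> * W n}\<close> (\<open>weighted_bound_if_con_bound\<close>) and a truncation of \<open>\<omega>\<close>
  (\<open>CF_bound_if_RH_bound\<close>). The step from \<open>CF\<close> to \<open>M_hat\<close> passes to complements
  (\<open>bound_if_CF_bound\<close>).

  The substance is in the two remaining steps, \<open>M \<Rightarrow> RH_q\<close> and \<open>M_hat \<Rightarrow> A_p\<close>. They are the same
  statement: \<open>M_hat\<close> is condition \<open>M\<close> for the measure \<open>\<nu>\<close> and the weight \<open>1 / \<omega>\<close>, and a reverse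
  Hoelder inequality for \<open>1 / \<omega>\<close> relative to \<open>\<nu>\<close> is an \<open>A_p\<close> condition for \<open>\<omega>\<close>. So a single
  result about a pair of measures is proved, \<open>power_comparison\<close>. Its idea is to follow the
  martingale \<open>W m / W n\<close>, \<open>m \<ge> n\<close>, through the levels \<open>L ^ k\<close>. By regularity, the martingale
  overshoots a level by a factor of at most \<open>C\<close> when first exceeding it, so Doob's maximal inequality
  bounds the conditional \<open>\<mu>\<close>-probability of exceeding the next level by \<open>C / L \<le> \<alpha>\<close>. Condition \<open>M\<close>
  turns this into a conditional \<open>\<nu>\<close>-probability of at most \<open>\<beta> < 1\<close>. Therefore level \<open>L ^ k\<close> is exceeded
  with conditional \<open>\<nu>\<close>-probability at most \<open>\<beta> ^ k\<close>. Since \<open>\<omega> \<le> L ^ k * W n\<close> where level \<open>L ^ k\<close>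
  is never exceeded (\<open>AE_le_off_exceed\<close>), a small power of \<open>\<omega> / W n\<close> has bounded conditional
  \<open>\<nu>\<close>-expectation, by summing a geometric series.
\<close>

section \<open>Comparing measures and functions\<close>

text \<open>
  The sets on which an inequality between two measures holds need not form a Dynkin system, so
  uniqueness of measures does not apply directly. Instead, the difference of the two measures is a
  finitely additive set function on the algebra, continuous at \<open>{}\<close> because it is dominated by
  \<open>N\<^sub>2\<close>. Its Caratheodory extension \<open>R\<close> satisfies \<open>N\<^sub>1 + R = N\<^sub>2\<close> on the algebra, hence everywhere.
\<close>

lemma emeasure_le_if_le_on_algebra:
  assumes alg: "algebra \<Omega> \<A>"
    and sets: "sets N\<^sub>1 = sigma_sets \<Omega> \<A>" "sets N\<^sub>2 = sigma_sets \<Omega> \<A>"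
    and fin: "finite_measure N\<^sub>1" "finite_measure N\<^sub>2"
    and le: "\<And>A. A \<in> \<A> \<Longrightarrow> emeasure N\<^sub>1 A \<le> emeasure N\<^sub>2 A"
    and A: "A \<in> sets N\<^sub>1"
  shows "emeasure N\<^sub>1 A \<le> emeasure N\<^sub>2 A"
proof -
  interpret alg: algebra \<Omega> \<A> by (rule alg)
  interpret N1: finite_measure N\<^sub>1 by (rule fin)
  interpret N2: finite_measure N\<^sub>2 by (rule fin)
  have mem: "B \<in> sets N\<^sub>1" "B \<in> sets N\<^sub>2" if "B \<in> \<A>" for B
    using that by (auto simp: sets)
  define f where "f B = emeasure N\<^sub>2 B - emeasure N\<^sub>1 B" for B
  have split: "emeasure N\<^sub>1 B + f B = emeasure N\<^sub>2 B" if "B \<in> \<A>" for B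
    using le[OF that] by (simp add: f_def add_diff_inverse_ennreal)
  have "positive \<A> f" by (simp add: positive_def f_def)
  moreover have "additive \<A> f"
  unfolding additive_def
  proof (intro ballI impI)
    fix x y assume xy: "x \<in> \<A>" "y \<in> \<A>" "x \<inter> y = {}"
    have "emeasure N\<^sub>1 (x \<union> y) + f (x \<union> y) = emeasure N\<^sub>2 (x \<union> y)"
      using xy by (intro split) auto
    also have "\<dots> = (emeasure N\<^sub>1 x + f x) + (emeasure N\<^sub>1 y + f y)"
      using xy mem by (simp add: split plus_emeasure)
    also have "\<dots> = emeasure N\<^sub>1 (x \<union> y) + (f x + f y)"
      using xy mem by (simp add: plus_emeasure[symmetric] ac_simps)
    finally show "f (x \<union> y) = f x + f y"
      by (simp add: ennreal_add_left_cancel)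
  qed
  moreover have f_le: "f B \<le> emeasure N\<^sub>2 B" for B
    by (simp add: f_def diff_le_self_ennreal)
  then have "f B \<noteq> \<infinity>" for B
    by (metis N2.emeasure_finite infinity_ennreal_def neq_top_trans)
  moreover have "(\<lambda>i. f (D i)) \<longlonglongrightarrow> 0"
    if D: "range D \<subseteq> \<A>" "decseq D" "(\<Inter>i. D i) = {}" for D
  proof (rule tendsto_sandwich[OF _ _ tendsto_const])
    have "(\<lambda>i. emeasure N\<^sub>2 (D i)) \<longlonglongrightarrow> emeasure N\<^sub>2 (\<Inter>i. D i)"
      using D mem by (intro Lim_emeasure_decseq) auto
    then show "(\<lambda>i. emeasure N\<^sub>2 (D i)) \<longlonglongrightarrow> 0" using D by simp
  qed (auto simp: f_le)
  ultimately obtain r where r: "\<And>B. B \<in> \<A> \<Longrightarrow> r B = f B"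
    and ms: "measure_space \<Omega> (sigma_sets \<Omega> \<A>) r"
    using alg.caratheodory_empty_continuous[of f] by blast
  define R where "R = measure_of \<Omega> (sigma_sets \<Omega> \<A>) r"
  have subP: "\<A> \<subseteq> Pow \<Omega>" by (rule alg.space_closed)
  have sR: "sets R = sigma_sets \<Omega> \<A>"
    unfolding R_def by (intro sigma_algebra.sets_measure_of_eq sigma_algebra_sigma_sets subP)
  have eR: "emeasure R B = r B" if "B \<in> sigma_sets \<Omega> \<A>" for B
    unfolding R_def using ms that
    by (simp add: measure_space_def emeasure_measure_of_sigma)
  define S where "S = measure_of \<Omega> (sigma_sets \<Omega> \<A>) (\<lambda>B. emeasure N\<^sub>1 B + emeasure R B)"
  have ms2: "measure_space \<Omega> (sigma_sets \<Omega> \<A>) (\<lambda>B. emeasure N\<^sub>1 B + emeasure R B)"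
    unfolding measure_space_def
  proof (intro conjI)
    show "sigma_algebra \<Omega> (sigma_sets \<Omega> \<A>)" using subP by (rule sigma_algebra_sigma_sets)
    show "countably_additive (sigma_sets \<Omega> \<A>) (\<lambda>B. emeasure N\<^sub>1 B + emeasure R B)"
      unfolding countably_additive_def
      by (auto simp: suminf_add[symmetric] suminf_emeasure sets sR)
  qed (simp add: positive_def)
  have sS: "sets S = sigma_sets \<Omega> \<A>"
    unfolding S_def by (intro sigma_algebra.sets_measure_of_eq sigma_algebra_sigma_sets subP)
  have eS: "emeasure S B = emeasure N\<^sub>1 B + emeasure R B" if "B \<in> sigma_sets \<Omega> \<A>" for B
    unfolding S_def using ms2 that
    by (simp add: measure_space_def emeasure_measure_of_sigma)
  have "N\<^sub>2 = S"
  proof (rule measure_eqI_generator_eq[where A="\<lambda>_. \<Omega>" and E=\<A> and \<Omega>=\<Omega>])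
    show "Int_stable \<A>" by (auto simp: Int_stable_def)
    show "emeasure N\<^sub>2 X = emeasure S X" if "X \<in> \<A>" for X
      using that by (simp add: eS eR r split)
  qed (use subP in \<open>auto simp: sets sS\<close>)
  then show ?thesis using A eS[of A] by (auto simp: sets)
qed

text \<open>
  On \<open>{v \<le> n, v < u}\<close> the integral of \<open>v\<close> is finite, so the integral of \<open>u - v\<close> over this set
  can be formed and has to vanish; the set is therefore null for every \<open>n\<close>. The truncation at \<open>n\<close>
  lets \<open>u\<close> and \<open>v\<close> take the value \<open>\<infinity>\<close>, as conditional expectations may.
\<close>

lemma (in finite_measure) AE_le_if_set_nn_integral_le:
  assumes [measurable]: "u \<in> borel_measurable M" "v \<in> borel_measurable M"
    and le: "\<And>A. A \<in> sets M \<Longrightarrow> (\<integral>\<^sup>+x\<in>A. u x \<partial>M) \<le> (\<integral>\<^sup>+x\<in>A. v x \<partial>M)"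
  shows "AE x in M. u x \<le> v x"
proof -
  have "AE x in M. v x \<le> of_nat n \<longrightarrow> u x \<le> v x" for n :: nat
  proof -
    define A where "A = {x \<in> space M. v x \<le> of_nat n \<and> v x < u x}"
    have [measurable]: "A \<in> sets M" unfolding A_def by measurable
    have "(\<integral>\<^sup>+x\<in>A. v x \<partial>M) \<le> (\<integral>\<^sup>+x. of_nat n \<partial>M)"
      by (rule nn_integral_mono) (auto simp: A_def indicator_def)
    also have "\<dots> < \<infinity>" by (simp add: ennreal_mult_less_top of_nat_less_top emeasure_finite less_top[symmetric] ennreal_mult_eq_top_iff)
    finally have fin: "(\<integral>\<^sup>+x\<in>A. v x \<partial>M) \<noteq> \<infinity>" by simp
    have "(\<integral>\<^sup>+x. u x * indicator A x - v x * indicator A x \<partial>M) = (\<integral>\<^sup>+x\<in>A. u x \<partial>M) - (\<integral>\<^sup>+x\<in>A. v x \<partial>M)"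
      using fin by (intro nn_integral_diff) (auto simp: A_def indicator_def)
    also have "\<dots> = 0" using le[of A] fin by (auto simp: diff_eq_0_iff_ennreal less_top[symmetric] top_unique)
    finally have "AE x in M. u x * indicator A x - v x * indicator A x = 0"
      by (subst (asm) nn_integral_0_iff_AE) auto
    with AE_space show ?thesis
    proof eventually_elim
      case (elim x)
      show ?case
      proof (rule impI, rule ccontr)
        assume "v x \<le> of_nat n" "\<not> u x \<le> v x"
        then have "x \<in> A" using elim by (auto simp: A_def)
        then have "u x - v x = 0" using elim by simp
        moreover have "v x < top" using \<open>v x \<le> of_nat n\<close> by (simp add: of_nat_less_top order_le_less_trans)
        ultimately show False using \<open>\<not> u x \<le> v x\<close> by (simp add: diff_eq_0_iff_ennreal)
      qed
    qed
  qed
  then have "AE x in M. \<forall>n::nat. v x \<le> of_nat n \<longrightarrow> u x \<le> v x"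
    unfolding AE_all_countable by blast
  then show ?thesis
  proof eventually_elim
    case (elim x)
    show ?case
    proof (cases "v x = top")
      case False
      then obtain n :: nat where "v x < of_nat n"
        using ennreal_Ex_less_of_nat[of "v x"] by (auto simp: less_top)
      then show ?thesis using elim by (auto intro: less_imp_le)
    qed simp
  qed
qed


section \<open>Inequalities between conditional expectations\<close>

text \<open>
  Testing a conditional bound on the sets of the subalgebra. This is how the conditions on weights,
  which are almost sure bounds, are translated to and from bounds on measures.
\<close>

lemma (in finite_measure_subalgebra) AE_nn_cond_exp_le_iff:
  assumes f[measurable]: "f \<in> borel_measurable M" and h[measurable]: "h \<in> borel_measurable F"
  shows "(AE x in M. nn_cond_exp M F f x \<le> h x) \<longleftrightarrow>
    (\<forall>B\<in>sets F. (\<integral>\<^sup>+x\<in>B. f x \<partial>M) \<le> (\<integral>\<^sup>+x\<in>B. h x \<partial>M))"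
proof -
  have intg: "(\<integral>\<^sup>+x\<in>B. f x \<partial>M) = (\<integral>\<^sup>+x\<in>B. nn_cond_exp M F f x \<partial>M)" if [measurable]: "B \<in> sets F" for B
    using nn_cond_exp_intg[of "indicator B" f] by (simp add: mult.commute)
  show ?thesis
  proof
    assume "AE x in M. nn_cond_exp M F f x \<le> h x"
    then show "\<forall>B\<in>sets F. (\<integral>\<^sup>+x\<in>B. f x \<partial>M) \<le> (\<integral>\<^sup>+x\<in>B. h x \<partial>M)"
      by (auto simp: intg intro!: nn_integral_mono_AE mult_right_mono)
  next
    assume *: "\<forall>B\<in>sets F. (\<integral>\<^sup>+x\<in>B. f x \<partial>M) \<le> (\<integral>\<^sup>+x\<in>B. h x \<partial>M)"
    let ?R = "restr_to_subalg M F"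
    have sR: "sets ?R = sets F" by (rule sets_restr_to_subalg[OF subalg])
    interpret R: finite_measure ?R
      by (rule finite_measure_restr_to_subalg[OF subalg finite_measure_axioms])
    have "AE x in ?R. nn_cond_exp M F f x \<le> h x"
    proof (rule R.AE_le_if_set_nn_integral_le)
      fix B assume "B \<in> sets ?R"
      then have [measurable]: "B \<in> sets F" by (simp add: sR)
      show "(\<integral>\<^sup>+x\<in>B. nn_cond_exp M F f x \<partial>?R) \<le> (\<integral>\<^sup>+x\<in>B. h x \<partial>?R)"
        using bspec[OF * \<open>B \<in> sets F\<close>] intg[of B] by (simp add: nn_integral_subalgebra2[OF subalg])
    qed (auto intro: measurable_in_subalg[OF subalg])
    then show "AE x in M. nn_cond_exp M F f x \<le> h x"
      by (rule AE_restr_to_subalg[OF subalg])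
  qed
qed

lemma (in finite_measure_subalgebra) AE_nn_cond_exp_indicator_le_iff:
  assumes A[measurable]: "A \<in> sets M"
  shows "(AE x in M. nn_cond_exp M F (indicator A) x \<le> c) \<longleftrightarrow>
    (\<forall>B\<in>sets F. emeasure M (A \<inter> B) \<le> c * emeasure M B)"
proof (subst AE_nn_cond_exp_le_iff)
  have "(\<integral>\<^sup>+x\<in>B. indicator A x \<partial>M) = emeasure M (A \<inter> B)"
    "(\<integral>\<^sup>+x\<in>B. c \<partial>M) = c * emeasure M B" if "B \<in> sets F" for B
  proof -
    have [measurable]: "B \<in> sets M" using that subalg by (auto simp: subalgebra_def)
    show "(\<integral>\<^sup>+x\<in>B. indicator A x \<partial>M) = emeasure M (A \<inter> B)"
      by (simp add: indicator_inter_arith[symmetric])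
    show "(\<integral>\<^sup>+x\<in>B. c \<partial>M) = c * emeasure M B"
      by (simp add: nn_integral_cmult_indicator)
  qed
  then show "(\<forall>B\<in>sets F. (\<integral>\<^sup>+x\<in>B. indicator A x \<partial>M) \<le> (\<integral>\<^sup>+x\<in>B. c \<partial>M)) \<longleftrightarrow>
    (\<forall>B\<in>sets F. emeasure M (A \<inter> B) \<le> c * emeasure M B)"
    by auto
qed auto

lemma (in sigma_finite_subalgebra) nn_cond_exp_affine:
  assumes [measurable]: "c \<in> borel_measurable F" "a \<in> borel_measurable F" "b \<in> borel_measurable F"
    "f \<in> borel_measurable M" "g \<in> borel_measurable M"
  shows "AE x in M. nn_cond_exp M F (\<lambda>y. c y + a y * f y + b y * g y) x =
    c x + a x * nn_cond_exp M F f x + b x * nn_cond_exp M F g x"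
proof -
  have [measurable]: "c \<in> borel_measurable M" "a \<in> borel_measurable M" "b \<in> borel_measurable M"
    by (rule measurable_from_subalg[OF subalg], simp)+
  have "AE x in M. nn_cond_exp M F (\<lambda>y. c y + a y * f y) x + nn_cond_exp M F (\<lambda>y. b y * g y) x
      = nn_cond_exp M F (\<lambda>y. c y + a y * f y + b y * g y) x"
    by (rule nn_cond_exp_sum) auto
  moreover have "AE x in M. nn_cond_exp M F c x + nn_cond_exp M F (\<lambda>y. a y * f y) x
      = nn_cond_exp M F (\<lambda>y. c y + a y * f y) x"
    by (rule nn_cond_exp_sum) auto
  moreover have "AE x in M. c x = nn_cond_exp M F c x" by (rule nn_cond_exp_F_meas) auto
  moreover have "AE x in M. a x * nn_cond_exp M F f x = nn_cond_exp M F (\<lambda>y. a y * f y) x"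
    "AE x in M. b x * nn_cond_exp M F g x = nn_cond_exp M F (\<lambda>y. b y * g y) x"
    by (rule nn_cond_exp_prod; simp)+
  ultimately show ?thesis by eventually_elim simp
qed

text \<open>
  Most of the implications between conditions come from one scheme: a pointwise inequality between two
  functions that are affine in at most two random variables, with coefficients known at time \<open>n\<close>,
  survives conditioning. Every term is kept nonnegative, by moving negative parts to the other side,
  so that conditional expectations may be infinite.
\<close>

lemma (in sigma_finite_subalgebra) nn_cond_exp_affine_mono:
  assumes le: "AE x in M. c x + a x * f x + b x * g x \<le> c' x + a' x * f' x + b' x * g' x"
    and [measurable]: "c \<in> borel_measurable F" "a \<in> borel_measurable F" "b \<in> borel_measurable F"
    "f \<in> borel_measurable M" "g \<in> borel_measurable M"
    "c' \<in> borel_measurable F" "a' \<in> borel_measurable F" "b' \<in> borel_measurable F"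
    "f' \<in> borel_measurable M" "g' \<in> borel_measurable M"
  shows "AE x in M. c x + a x * nn_cond_exp M F f x + b x * nn_cond_exp M F g x
    \<le> c' x + a' x * nn_cond_exp M F f' x + b' x * nn_cond_exp M F g' x"
proof -
  have [measurable]: "c \<in> borel_measurable M" "a \<in> borel_measurable M" "b \<in> borel_measurable M"
    "c' \<in> borel_measurable M" "a' \<in> borel_measurable M" "b' \<in> borel_measurable M"
    by (rule measurable_from_subalg[OF subalg], simp)+
  have "AE x in M. nn_cond_exp M F (\<lambda>y. c y + a y * f y + b y * g y) x
      \<le> nn_cond_exp M F (\<lambda>y. c' y + a' y * f' y + b' y * g' y) x"
    by (rule nn_cond_exp_mono[OF le]) auto
  moreover have "AE x in M. nn_cond_exp M F (\<lambda>y. c y + a y * f y + b y * g y) x =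
    c x + a x * nn_cond_exp M F f x + b x * nn_cond_exp M F g x"
    "AE x in M. nn_cond_exp M F (\<lambda>y. c' y + a' y * f' y + b' y * g' y) x =
    c' x + a' x * nn_cond_exp M F f' x + b' x * nn_cond_exp M F g' x"
    by (rule nn_cond_exp_affine; simp)+
  ultimately show ?thesis by eventually_elim simp
qed

section \<open>The density process of a pair of measures\<close>

text \<open>
  A measure \<open>\<nu>\<close> with density \<open>w\<close> with respect to \<open>\<mu>\<close>, and the densities \<open>W n\<close> of the restrictions
  to the \<open>\<sigma>\<close>-algebras \<open>F n\<close>. The setting treats \<open>\<mu>\<close> and \<open>\<nu>\<close> alike: it is used
  once for \<open>\<nu> = \<omega> d\<mu>\<close> and once with the two measures exchanged and \<open>1 / \<omega>\<close> as density. In the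
  second case, bounded growth of the process is the lower bound in the regularity condition.
\<close>

locale density_process =
  fixes \<mu> \<nu> :: "'a measure" and F :: "nat \<Rightarrow> 'a measure"
    and w :: "'a \<Rightarrow> real" and W :: "nat \<Rightarrow> 'a \<Rightarrow> real" and C :: real
  assumes finite_\<mu>: "finite_measure \<mu>" and finite_\<nu>: "finite_measure \<nu>"
    and w_meas[measurable]: "w \<in> borel_measurable \<mu>"
    and \<nu>_eq: "\<nu> = density \<mu> (\<lambda>x. ennreal (w x))"
    and subalg: "\<And>n. subalgebra \<mu> (F n)"
    and sets_mono: "\<And>m n. m \<le> n \<Longrightarrow> sets (F m) \<subseteq> sets (F n)"
    and generating: "sets \<mu> = sigma_sets (space \<mu>) (\<Union>n. sets (F n))"
    and W_meas[measurable]: "\<And>n. W n \<in> borel_measurable (F n)"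
    and W_pos: "\<And>n x. 0 < W n x"
    and W_density: "\<And>n f. f \<in> borel_measurable (F n) \<Longrightarrow>
          (\<integral>\<^sup>+x. f x \<partial>\<nu>) = (\<integral>\<^sup>+x. f x * ennreal (W n x) \<partial>\<mu>)"
    and W_growth: "\<And>n. AE x in \<mu>. W (Suc n) x \<le> C * W n x"
begin

lemma sets_\<nu>[simp, measurable_cong]: "sets \<nu> = sets \<mu>"
  and space_\<nu>[simp]: "space \<nu> = space \<mu>"
  by (simp_all add: \<nu>_eq)

lemma space_F[simp]: "space (F n) = space \<mu>"
  using subalg by (simp add: subalgebra_def)

lemma sets_F_D: "A \<in> sets (F n) \<Longrightarrow> A \<in> sets \<mu>"
  using subalg[of n] by (auto simp: subalgebra_def)

lemma W_meas_mono: "m \<le> n \<Longrightarrow> W m \<in> borel_measurable (F n)"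
  by (rule measurable_from_subalg[OF _ W_meas]) (simp add: subalgebra_def sets_mono)

lemma W_meas_\<mu>[measurable]: "W n \<in> borel_measurable \<mu>"
  using measurable_from_subalg[OF subalg W_meas] .

lemma AE_\<nu>: "(AE x in \<mu>. P x) \<Longrightarrow> (AE x in \<nu>. P x)"
  unfolding \<nu>_eq by (subst AE_density) (auto elim: eventually_mono)

text \<open>
  The event that after time \<open>n\<close> the process exceeds \<open>c\<close> times its value at time \<open>n\<close>; it is split
  below according to the first delay \<open>j\<close> at which this happens.
\<close>

definition exceed :: "nat \<Rightarrow> real \<Rightarrow> 'a set" where
  "exceed n c = {x \<in> space \<mu>. \<exists>j. c * W n x < W (n + j) x}"

definition first_exceed :: "nat \<Rightarrow> real \<Rightarrow> nat \<Rightarrow> 'a set" where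
  "first_exceed n c j =
     {x \<in> space \<mu>. c * W n x < W (n + j) x \<and> (\<forall>i<j. W (n + i) x \<le> c * W n x)}"

lemma below_sets_F: "i \<le> m \<Longrightarrow> {x \<in> space \<mu>. W (n + i) x \<le> c * W n x} \<in> sets (F (n + m))"
proof -
  assume "i \<le> m"
  then have [measurable]: "W (n + i) \<in> borel_measurable (F (n + m))" "W n \<in> borel_measurable (F (n + m))"
    by (simp_all add: W_meas_mono)
  have "{x \<in> space (F (n + m)). W (n + i) x \<le> c * W n x} \<in> sets (F (n + m))" by measurable
  then show ?thesis by simp
qed

lemma first_exceed_sets_F: "first_exceed n c j \<in> sets (F (n + j))"
proof -
  let ?U = "\<lambda>i. {x \<in> space \<mu>. W (n + i) x \<le> c * W n x}"
  have "first_exceed n c j = (space (F (n + j)) - ?U j) - (\<Union>i<j. space (F (n + j)) - ?U i)"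
    by (auto simp: first_exceed_def)
  also have "\<dots> \<in> sets (F (n + j))"
    by (intro sets.Diff sets.top sets.finite_UN below_sets_F) auto
  finally show ?thesis .
qed

lemma first_exceed_sets[measurable]: "first_exceed n c j \<in> sets \<mu>"
  using first_exceed_sets_F by (rule sets_F_D)

lemma exceed_eq_UN: "exceed n c = (\<Union>j. first_exceed n c j)"
proof (intro equalityI subsetI)
  fix x assume x: "x \<in> exceed n c"
  let ?P = "\<lambda>j. c * W n x < W (n + j) x"
  from x have "\<exists>j. ?P j" by (auto simp: exceed_def)
  then have "?P (LEAST j. ?P j)" by (rule LeastI_ex)
  moreover have "\<forall>i<(LEAST j. ?P j). W (n + i) x \<le> c * W n x"
    using not_less_Least[of _ ?P] by (auto simp: not_less)
  ultimately show "x \<in> (\<Union>j. first_exceed n c j)"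
    using x by (auto simp: first_exceed_def exceed_def)
qed (auto simp: exceed_def first_exceed_def)

lemma exceed_sets[measurable]: "exceed n c \<in> sets \<mu>"
  unfolding exceed_eq_UN by auto

lemma disjoint_first_exceed: "disjoint_family (\<lambda>j. first_exceed n c j)"
proof -
  have "x \<notin> first_exceed n c k" if "x \<in> first_exceed n c j" "j < k" for x j k
    using that by (auto simp: first_exceed_def not_less)
  then have "first_exceed n c j \<inter> first_exceed n c k = {}" if "j \<noteq> k" for j k
    using that by (cases j k rule: linorder_cases) blast+
  then show ?thesis by (simp add: disjoint_family_on_def)
qed

lemma emeasure_Int_exceed:
  assumes "sets N = sets \<mu>" "A \<in> sets \<mu>"
  shows "emeasure N (A \<inter> exceed n c) = (\<Sum>j. emeasure N (A \<inter> first_exceed n c j))"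
proof -
  have "(\<Sum>j. emeasure N (A \<inter> first_exceed n c j)) = emeasure N (\<Union>j. A \<inter> first_exceed n c j)"
    using assms disjoint_first_exceed[of n c]
    by (intro suminf_emeasure) (auto simp: disjoint_family_on_def)
  then show ?thesis by (simp add: exceed_eq_UN)
qed

text \<open>
  Doob's maximal inequality for the martingale \<open>W (n + j) / W n\<close>. On the part where level \<open>c\<close> is first
  exceeded with delay \<open>j\<close>, the constant \<open>c\<close> is at most \<open>W (n + j) / W n\<close>, and the \<open>\<mu>\<close>-integral of
  this quotient is the \<open>\<nu>\<close>-integral of \<open>1 / W n\<close>. Summing over \<open>j\<close> gives a \<open>\<nu>\<close>-integral of \<open>1 / W n\<close>
  over a subset of \<open>B\<close>, and the one over \<open>B\<close> equals \<open>\<mu> B\<close>.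
\<close>

lemma maximal_inequality:
  assumes B: "B \<in> sets (F n)" and c: "0 \<le> c"
  shows "ennreal c * emeasure \<mu> (B \<inter> exceed n c) \<le> emeasure \<mu> B"
proof -
  have [measurable]: "B \<in> sets \<mu>" by (rule sets_F_D[OF B])
  have piece: "ennreal c * emeasure \<mu> (B \<inter> first_exceed n c j)
      \<le> (\<integral>\<^sup>+x. ennreal (1 / W n x) * indicator (B \<inter> first_exceed n c j) x \<partial>\<nu>)" for j
  proof -
    have [measurable]: "B \<in> sets (F (n + j))" "W n \<in> borel_measurable (F (n + j))"
      "first_exceed n c j \<in> sets (F (n + j))"
      using B sets_mono[of n "n + j"] W_meas_mono first_exceed_sets_F by auto
    have "ennreal c * emeasure \<mu> (B \<inter> first_exceed n c j)
        = (\<integral>\<^sup>+x. ennreal c * indicator (B \<inter> first_exceed n c j) x \<partial>\<mu>)"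
      by (subst nn_integral_cmult_indicator) auto
    also have "\<dots> \<le> (\<integral>\<^sup>+x. ennreal (1 / W n x) * indicator (B \<inter> first_exceed n c j) x * ennreal (W (n + j) x) \<partial>\<mu>)"
    proof (rule nn_integral_mono)
      fix x
      show "ennreal c * indicator (B \<inter> first_exceed n c j) x
          \<le> ennreal (1 / W n x) * indicator (B \<inter> first_exceed n c j) x * ennreal (W (n + j) x)"
        using W_pos[of n x] W_pos[of "n + j" x]
        by (auto simp: indicator_def first_exceed_def ennreal_mult[symmetric] pos_le_divide_eq
            intro!: ennreal_leI)
    qed
    also have "\<dots> = (\<integral>\<^sup>+x. ennreal (1 / W n x) * indicator (B \<inter> first_exceed n c j) x \<partial>\<nu>)"
      by (rule W_density[symmetric]) measurable
    finally show ?thesis .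
  qed
  have "ennreal c * emeasure \<mu> (B \<inter> exceed n c)
      = (\<Sum>j. ennreal c * emeasure \<mu> (B \<inter> first_exceed n c j))"
    by (simp add: emeasure_Int_exceed)
  also have "\<dots> \<le> (\<Sum>j. \<integral>\<^sup>+x. ennreal (1 / W n x) * indicator (B \<inter> first_exceed n c j) x \<partial>\<nu>)"
    by (intro suminf_le piece) auto
  also have "\<dots> = (\<integral>\<^sup>+x. (\<Sum>j. ennreal (1 / W n x) * indicator (B \<inter> first_exceed n c j) x) \<partial>\<nu>)"
    by (rule nn_integral_suminf[symmetric]) auto
  also have "\<dots> \<le> (\<integral>\<^sup>+x. ennreal (1 / W n x) * indicator B x \<partial>\<nu>)"
  proof (rule nn_integral_mono)
    fix x
    have "disjoint_family (\<lambda>j. B \<inter> first_exceed n c j)"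
      using disjoint_first_exceed[of n c] by (auto simp: disjoint_family_on_def)
    then have "(\<Sum>j. indicator (B \<inter> first_exceed n c j) x :: ennreal) = indicator (\<Union>j. B \<inter> first_exceed n c j) x"
      by (rule suminf_indicator)
    then show "(\<Sum>j. ennreal (1 / W n x) * indicator (B \<inter> first_exceed n c j) x) \<le> ennreal (1 / W n x) * indicator B x"
      by (auto simp: ennreal_suminf_cmult indicator_def)
  qed
  also have "\<dots> = (\<integral>\<^sup>+x. ennreal (1 / W n x) * indicator B x * ennreal (W n x) \<partial>\<mu>)"
    by (rule W_density) (use B in measurable)
  also have "\<dots> = (\<integral>\<^sup>+x. indicator B x \<partial>\<mu>)"
    using W_pos[of n] by (intro nn_integral_cong) (auto simp: indicator_def ennreal_mult[symmetric] less_le)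
  also have "\<dots> = emeasure \<mu> B" by simp
  finally show ?thesis .
qed

text \<open>
  This takes the place of the almost sure convergence \<open>W m \<longlonglongrightarrow> w\<close>. Let \<open>G\<close> be the complement of
  the event. For \<open>D\<close> in some \<open>F p\<close> and \<open>m\<close> large, \<open>\<nu> (D \<inter> G)\<close> is at most the integral of
  \<open>W (n + m)\<close> over the set of points of \<open>D\<close> at which level \<open>c\<close> has not been exceeded up to
  delay \<open>m\<close>, hence at most the integral of \<open>c * W n\<close> over that set. These sets decrease to
  \<open>D \<inter> G\<close> as \<open>m \<longlonglongrightarrow> \<infinity>\<close>, so \<open>w\<close> has at most the integral of \<open>c * W n\<close> over \<open>D \<inter> G\<close>. The sets \<open>D\<close> form
  a generating algebra, so the inequality extends to all measurable sets and then to the densities.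
\<close>

lemma AE_le_off_exceed:
  assumes c: "1 \<le> c"
  shows "AE x in \<mu>. x \<notin> exceed n c \<longrightarrow> w x \<le> c * W n x"
proof -
  interpret \<mu>: finite_measure \<mu> by (rule finite_\<mu>)
  interpret \<nu>: finite_measure \<nu> by (rule finite_\<nu>)
  define G where "G = space \<mu> - exceed n c"
  have [measurable]: "G \<in> sets \<mu>" by (auto simp: G_def)
  define R where "R m = {x \<in> space \<mu>. \<forall>i\<le>m. W (n + i) x \<le> c * W n x}" for m
  have R_F: "R m \<in> sets (F (n + m))" for m
  proof -
    have "R m = (\<Inter>i\<le>m. {x \<in> space \<mu>. W (n + i) x \<le> c * W n x})"
      by (auto simp: R_def)
    also have "\<dots> \<in> sets (F (n + m))"
      by (intro sets.finite_INT below_sets_F) auto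
    finally show ?thesis .
  qed
  then have R_sets[measurable]: "R m \<in> sets \<mu>" for m by (rule sets_F_D)
  have G_eq: "G = (\<Inter>m. R m)"
    by (auto simp: G_def R_def exceed_def not_less) (meson leD le_refl)
  define N\<^sub>1 where "N\<^sub>1 = density \<mu> (\<lambda>x. ennreal (w x) * indicator G x)"
  define N\<^sub>2 where "N\<^sub>2 = density \<mu> (\<lambda>x. ennreal (c * W n x) * indicator G x)"
  define N where "N = density \<mu> (\<lambda>x. ennreal (c * W n x))"
  have N1: "emeasure N\<^sub>1 A = emeasure \<nu> (A \<inter> G)" if [measurable]: "A \<in> sets \<mu>" for A
    unfolding N\<^sub>1_def \<nu>_eq
    by (simp add: emeasure_density) (auto intro!: nn_integral_cong simp: indicator_def)
  have N2: "emeasure N\<^sub>2 A = emeasure N (A \<inter> G)" if [measurable]: "A \<in> sets \<mu>" for A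
    unfolding N\<^sub>2_def N_def
    by (simp add: emeasure_density) (auto intro!: nn_integral_cong simp: indicator_def)
  have N_F: "emeasure N (space \<mu>) = ennreal c * emeasure \<nu> (space \<mu>)"
  proof -
    have "emeasure N (space \<mu>) = (\<integral>\<^sup>+x. ennreal c * ennreal (W n x) \<partial>\<mu>)"
      unfolding N_def using c W_pos[of n]
      by (subst emeasure_density) (auto intro!: nn_integral_cong simp: ennreal_mult less_imp_le)
    also have "\<dots> = (\<integral>\<^sup>+x. ennreal c \<partial>\<nu>)" by (rule W_density[symmetric]) auto
    finally show ?thesis by simp
  qed
  have finN: "finite_measure N"
    by (rule finite_measureI) (use N_F \<nu>.emeasure_finite[of "space \<mu>"] in
        \<open>simp add: N_def ennreal_mult_eq_top_iff\<close>)
  then interpret N: finite_measure N .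
  have fin1: "finite_measure N\<^sub>1"
    by (rule finite_measureI) (use \<nu>.emeasure_finite in \<open>simp add: N1 N\<^sub>1_def[THEN arg_cong, of space]\<close>)
  have fin2: "finite_measure N\<^sub>2"
    by (rule finite_measureI) (use N.emeasure_finite in \<open>simp add: N2 N\<^sub>2_def[THEN arg_cong, of space]\<close>)
  have on_F: "emeasure N\<^sub>1 D \<le> emeasure N\<^sub>2 D" if D: "D \<in> sets (F p)" for D p
  proof -
    have [measurable]: "D \<in> sets \<mu>" using D by (rule sets_F_D)
    have step: "emeasure \<nu> (D \<inter> G) \<le> emeasure N (D \<inter> R m)" if "p \<le> n + m" for m
    proof -
      have D': "D \<in> sets (F (n + m))" using D sets_mono[OF that] by auto
      have "emeasure \<nu> (D \<inter> G) \<le> emeasure \<nu> (D \<inter> R m)"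
        by (intro emeasure_mono) (auto simp: G_eq)
      also have "\<dots> = (\<integral>\<^sup>+x. indicator (D \<inter> R m) x \<partial>\<nu>)" by simp
      also have "\<dots> = (\<integral>\<^sup>+x. indicator (D \<inter> R m) x * ennreal (W (n + m) x) \<partial>\<mu>)"
        using D' R_F by (intro W_density) auto
      also have "\<dots> \<le> (\<integral>\<^sup>+x. ennreal (c * W n x) * indicator (D \<inter> R m) x \<partial>\<mu>)"
        by (intro nn_integral_mono) (auto simp: indicator_def R_def intro!: ennreal_leI)
      also have "\<dots> = emeasure N (D \<inter> R m)" unfolding N_def
        by (subst emeasure_density) auto
      finally show ?thesis .
    qed
    have "(\<lambda>m. emeasure N (D \<inter> R m)) \<longlonglongrightarrow> emeasure N (\<Inter>m. D \<inter> R m)"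
    proof (intro Lim_emeasure_decseq)
      show "range (\<lambda>m. D \<inter> R m) \<subseteq> sets N" by (auto simp: N_def)
      show "decseq (\<lambda>m. D \<inter> R m)" by (auto simp: decseq_def R_def)
    qed (simp add: N.emeasure_finite)
    then have "emeasure \<nu> (D \<inter> G) \<le> emeasure N (\<Inter>m. D \<inter> R m)"
      by (rule LIMSEQ_le_const) (use step in \<open>auto intro!: exI[of _ p]\<close>)
    also have "(\<Inter>m. D \<inter> R m) = D \<inter> G" by (auto simp: G_eq)
    finally show ?thesis by (simp add: N1 N2)
  qed
  have alg: "algebra (space \<mu>) (\<Union>n. sets (F n))"
  proof (rule algebra_iff_Un[THEN iffD2], intro conjI ballI)
    show "(\<Union>n. sets (F n)) \<subseteq> Pow (space \<mu>)" using sets.sets_into_space by fastforce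
    show "{} \<in> (\<Union>n. sets (F n))" by auto
    show "space \<mu> - a \<in> (\<Union>n. sets (F n))" if "a \<in> (\<Union>n. sets (F n))" for a
      using that sets.compl_sets[of a "F _"] by auto
    fix a b assume "a \<in> (\<Union>n. sets (F n))" "b \<in> (\<Union>n. sets (F n))"
    then obtain i j where "a \<in> sets (F i)" "b \<in> sets (F j)" by auto
    then have "a \<union> b \<in> sets (F (max i j))"
      using sets_mono[of i "max i j"] sets_mono[of j "max i j"] by auto
    then show "a \<union> b \<in> (\<Union>n. sets (F n))" by blast
  qed
  have "AE x in \<mu>. ennreal (w x) * indicator G x \<le> ennreal (c * W n x) * indicator G x"
  proof (rule \<mu>.AE_le_if_set_nn_integral_le)
    fix A assume A[measurable]: "A \<in> sets \<mu>"
    have "emeasure N\<^sub>1 A \<le> emeasure N\<^sub>2 A"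
      by (rule emeasure_le_if_le_on_algebra[OF alg _ _ fin1 fin2])
        (use on_F A in \<open>auto simp: N\<^sub>1_def N\<^sub>2_def generating\<close>)
    then show "(\<integral>\<^sup>+x\<in>A. ennreal (w x) * indicator G x \<partial>\<mu>) \<le> (\<integral>\<^sup>+x\<in>A. ennreal (c * W n x) * indicator G x \<partial>\<mu>)"
      by (simp add: N\<^sub>1_def N\<^sub>2_def emeasure_density)
  qed auto
  with AE_space show ?thesis
  proof eventually_elim
    case (elim x)
    have "0 < c * W n x" using c W_pos[of n x] by simp
    then show ?case using elim by (auto simp: G_def ennreal_le_iff)
  qed
qed

end

context density_process
begin

lemma exceed_antimono: "c \<le> d \<Longrightarrow> exceed n d \<subseteq> exceed n c"
  unfolding exceed_def using W_pos[of n]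
  by (auto intro: order_le_less_trans[OF mult_right_mono[OF _ less_imp_le[OF W_pos]]])

text \<open>
  The step at which regularity is used: when level \<open>K\<close> is first exceeded, the process overshoots
  it by a factor of at most \<open>C\<close>. To reach level \<open>K * a\<close> it then still has to grow by a factor of \<open>a / C\<close>.
\<close>

lemma AE_exceed_again:
  assumes K: "1 \<le> K" and a: "1 \<le> a" and C: "0 < C"
  shows "AE x in \<mu>. x \<in> exceed n (K * a) \<inter> first_exceed n K j \<longrightarrow> x \<in> exceed (n + j) (a / C)"
proof -
  have "AE x in \<mu>. \<forall>m. W (Suc m) x \<le> C * W m x"
    using W_growth by (simp add: AE_all_countable)
  then show ?thesis
  proof (eventually_elim, intro impI)
    fix x assume growth: "\<forall>m. W (Suc m) x \<le> C * W m x"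
      and x: "x \<in> exceed n (K * a) \<inter> first_exceed n K j"
    from x obtain m where m: "K * a * W n x < W (n + m) x" and sp: "x \<in> space \<mu>"
      by (auto simp: exceed_def)
    from x have j: "K * W n x < W (n + j) x" and below: "\<And>i. i < j \<Longrightarrow> W (n + i) x \<le> K * W n x"
      by (auto simp: first_exceed_def)
    have Wn: "0 < W n x" by (rule W_pos)
    \<comment> \<open>At delay \<open>0\<close> the level is not exceeded, so the process has a value just before, below the level.\<close>
    have "W n x \<le> K * W n x" using K Wn by simp
    then have "j \<noteq> 0" using j by (cases "j = 0") auto
    then obtain i where i: "j = Suc i" by (cases j) auto
    have "W (n + j) x \<le> C * W (n + i) x" using growth by (simp add: i)
    also have "\<dots> \<le> C * (K * W n x)" using below[of i] C by (simp add: i)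
    finally have "a / C * W (n + j) x \<le> a / C * (C * (K * W n x))"
      using a C by (intro mult_left_mono) auto
    also have "\<dots> = K * a * W n x" using C by simp
    also note m
    finally have *: "a / C * W (n + j) x < W (n + m) x" .
    have "K * W n x \<le> K * a * W n x" using K a Wn by (simp add: mult_le_cancel_left1)
    then have "\<not> m < j" using below[of m] m by auto
    then have "n + m = n + j + (m - j)" by simp
    with * have "a / C * W (n + j) x < W (n + j + (m - j)) x" by metis
    with sp show "x \<in> exceed (n + j) (a / C)" unfolding exceed_def by blast
  qed
qed

lemma nn_integral_le_if_emeasure_le:
  assumes [measurable]: "A \<in> sets \<mu>" "h \<in> borel_measurable (F n)"
    and le: "\<And>B. B \<in> sets (F n) \<Longrightarrow> emeasure \<nu> (A \<inter> B) \<le> ennreal b * emeasure \<nu> B"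
  shows "(\<integral>\<^sup>+x. indicator A x * h x \<partial>\<nu>) \<le> ennreal b * (\<integral>\<^sup>+x. h x \<partial>\<nu>)"
proof -
  have sub: "subalgebra \<nu> (F n)" using subalg[of n] by (simp add: subalgebra_def)
  interpret N: finite_measure_subalgebra \<nu> "F n"
    using finite_\<nu> sub by (simp add: finite_measure_subalgebra_def finite_measure_subalgebra_axioms_def)
  have [measurable]: "h \<in> borel_measurable \<mu>" by (rule measurable_from_subalg[OF subalg assms(2)])
  have "AE x in \<nu>. nn_cond_exp \<nu> (F n) (indicator A) x \<le> ennreal b"
    using le by (simp add: N.AE_nn_cond_exp_indicator_le_iff)
  then have "(\<integral>\<^sup>+x. h x * nn_cond_exp \<nu> (F n) (indicator A) x \<partial>\<nu>) \<le> (\<integral>\<^sup>+x. h x * ennreal b \<partial>\<nu>)"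
    by (intro nn_integral_mono_AE) (auto elim!: eventually_mono intro: mult_left_mono)
  then show ?thesis
    by (subst (asm) N.nn_cond_exp_intg) (simp_all add: mult.commute nn_integral_cmult)
qed

end

section \<open>Self-improvement of Muckenhoupt's condition\<close>

text \<open>
  The measure-theoretic form of Muckenhoupt's condition: a set that is conditionally small for \<open>\<mu>\<close>
  is not conditionally full for \<open>\<nu>\<close>. The factor \<open>L\<close> between consecutive levels is so large that,
  after an overshoot by \<open>C\<close>, reaching the next level has conditional \<open>\<mu>\<close>-probability at most \<open>\<alpha>\<close>.
\<close>

locale small_sets_process = density_process +
  fixes \<alpha> \<beta> L :: real
  assumes \<alpha>: "0 < \<alpha>" and \<beta>: "0 < \<beta>" "\<beta> < 1" and C: "0 < C"
    and L: "1 < L" "C \<le> \<alpha> * L"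
    and small: "\<And>n A. A \<in> sets \<mu> \<Longrightarrow>
      (\<And>B. B \<in> sets (F n) \<Longrightarrow> emeasure \<mu> (A \<inter> B) \<le> ennreal \<alpha> * emeasure \<mu> B) \<Longrightarrow>
      (\<And>B. B \<in> sets (F n) \<Longrightarrow> emeasure \<nu> (A \<inter> B) \<le> ennreal \<beta> * emeasure \<nu> B)"
begin

text \<open>
  Condition on the moment at which level \<open>K\<close> is first exceeded. By the maximal inequality the
  conditional \<open>\<mu>\<close>-probability of going on to exceed \<open>K * L\<close> is at most \<open>C / L \<le> \<alpha>\<close>, so the
  hypothesis turns it into a conditional \<open>\<nu>\<close>-probability of at most \<open>\<beta>\<close>.
\<close>

lemma emeasure_exceed_step:
  assumes B: "B \<in> sets (F n)" and K: "1 \<le> K"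
  shows "emeasure \<nu> (B \<inter> exceed n (K * L)) \<le> ennreal \<beta> * emeasure \<nu> (B \<inter> exceed n K)"
proof -
  have [measurable]: "B \<in> sets \<mu>" by (rule sets_F_D[OF B])
  have piece: "emeasure \<nu> (B \<inter> exceed n (K * L) \<inter> first_exceed n K j)
      \<le> ennreal \<beta> * emeasure \<nu> (B \<inter> first_exceed n K j)" for j
  proof -
    let ?A = "exceed n (K * L) \<inter> first_exceed n K j"
    have "emeasure \<mu> (?A \<inter> D) \<le> ennreal \<alpha> * emeasure \<mu> D" if D: "D \<in> sets (F (n + j))" for D
    proof -
      have [measurable]: "D \<in> sets \<mu>" by (rule sets_F_D[OF D])
      have "emeasure \<mu> (?A \<inter> D) \<le> emeasure \<mu> (D \<inter> exceed (n + j) (L / C))"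
        using AE_exceed_again[OF K less_imp_le[OF L(1)], of n j] C
        by (intro emeasure_mono_AE) auto
      moreover have "ennreal (L / C) * emeasure \<mu> (D \<inter> exceed (n + j) (L / C)) \<le> emeasure \<mu> D"
        using L C by (intro maximal_inequality[OF D]) auto
      then have "ennreal \<alpha> * (ennreal (L / C) * emeasure \<mu> (D \<inter> exceed (n + j) (L / C))) \<le> ennreal \<alpha> * emeasure \<mu> D"
        by (rule mult_left_mono) simp
      moreover have "1 \<le> ennreal \<alpha> * ennreal (L / C)"
        using L C \<alpha> by (simp add: ennreal_mult[symmetric] pos_le_divide_eq ennreal_ge_1)
      then have "1 * emeasure \<mu> (D \<inter> exceed (n + j) (L / C)) \<le> ennreal \<alpha> * ennreal (L / C) * emeasure \<mu> (D \<inter> exceed (n + j) (L / C))"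
        by (rule mult_right_mono) simp
      ultimately show ?thesis by (simp add: mult.assoc) 
    qed
    moreover have "B \<inter> first_exceed n K j \<in> sets (F (n + j))"
      using B sets_mono[of n "n + j"] first_exceed_sets_F by auto
    ultimately have "emeasure \<nu> (?A \<inter> (B \<inter> first_exceed n K j)) \<le> ennreal \<beta> * emeasure \<nu> (B \<inter> first_exceed n K j)"
      by (intro small) auto
    then show ?thesis by (simp add: ac_simps)
  qed
  have "exceed n (K * L) \<subseteq> exceed n K"
    using K L by (intro exceed_antimono) (simp add: mult_le_cancel_left1)
  then have "B \<inter> exceed n (K * L) = B \<inter> exceed n (K * L) \<inter> exceed n K" by auto
  then have "emeasure \<nu> (B \<inter> exceed n (K * L)) = emeasure \<nu> (B \<inter> exceed n (K * L) \<inter> exceed n K)" by simp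
  also have "\<dots> = (\<Sum>j. emeasure \<nu> (B \<inter> exceed n (K * L) \<inter> first_exceed n K j))"
    by (rule emeasure_Int_exceed) auto
  also have "\<dots> \<le> (\<Sum>j. ennreal \<beta> * emeasure \<nu> (B \<inter> first_exceed n K j))"
    by (intro suminf_le piece) auto
  also have "\<dots> = ennreal \<beta> * emeasure \<nu> (B \<inter> exceed n K)"
    by (simp add: emeasure_Int_exceed)
  finally show ?thesis .
qed

lemma emeasure_exceed_power:
  assumes B: "B \<in> sets (F n)"
  shows "emeasure \<nu> (exceed n (L ^ k) \<inter> B) \<le> ennreal (\<beta> ^ k) * emeasure \<nu> B"
proof (induction k)
  case 0
  have [measurable]: "B \<in> sets \<mu>" by (rule sets_F_D[OF B])
  show ?case by (auto intro: emeasure_mono)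
next
  case (Suc k)
  have "emeasure \<nu> (exceed n (L ^ Suc k) \<inter> B) \<le> ennreal \<beta> * emeasure \<nu> (B \<inter> exceed n (L ^ k))"
    using emeasure_exceed_step[OF B, of "L ^ k"] L by (simp add: Int_commute mult.commute)
  also have "\<dots> \<le> ennreal \<beta> * (ennreal (\<beta> ^ k) * emeasure \<nu> B)"
    using Suc.IH by (intro mult_left_mono) (simp_all add: Int_commute)
  finally show ?case using \<beta> by (simp add: ennreal_mult ac_simps)
qed

lemma AE_leaves_exceed: "AE x in \<nu>. \<exists>k. x \<notin> exceed n (L ^ k)"
proof -
  interpret \<nu>: finite_measure \<nu> by (rule finite_\<nu>)
  define Z where "Z = (\<Inter>k. exceed n (L ^ k))"
  have Z[measurable]: "Z \<in> sets \<mu>" unfolding Z_def by auto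
  have le: "measure \<nu> Z \<le> \<beta> ^ k * measure \<nu> (space \<mu>)" for k
  proof -
    have "emeasure \<nu> Z \<le> emeasure \<nu> (exceed n (L ^ k) \<inter> space \<mu>)"
      by (rule emeasure_mono) (auto simp: Z_def exceed_def)
    also have "\<dots> \<le> ennreal (\<beta> ^ k) * emeasure \<nu> (space \<mu>)"
      by (rule emeasure_exceed_power) (metis sets.top space_F)
    finally show ?thesis
      using \<beta> by (simp add: \<nu>.emeasure_eq_measure ennreal_mult[symmetric])
  qed
  have "(\<lambda>k. \<beta> ^ k * measure \<nu> (space \<mu>)) \<longlonglongrightarrow> 0 * measure \<nu> (space \<mu>)"
    using \<beta> by (intro tendsto_mult LIMSEQ_realpow_zero) auto
  then have "measure \<nu> Z \<le> 0 * measure \<nu> (space \<mu>)"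
    by (rule LIMSEQ_le_const) (use le in auto)
  then have "emeasure \<nu> Z = 0"
    using measure_nonneg[of \<nu> Z] by (simp add: \<nu>.emeasure_eq_measure)
  then have "AE x in \<nu>. x \<notin> Z" by (intro AE_not_in) auto
  then show ?thesis by eventually_elim (auto simp: Z_def)
qed

text \<open>
  The Gehring-type self-improvement. Outside \<open>exceed n (L ^ k)\<close> the density \<open>w\<close> is at most
  \<open>L ^ k * W n\<close>, while that event has conditional \<open>\<nu>\<close>-mass at most \<open>\<beta> ^ k\<close>. Hence the \<open>s\<close>-th
  power of \<open>w / W n\<close> is integrated by a geometric series of ratio \<open>L powr s * \<beta>\<close>, which
  converges for small \<open>s\<close>.
\<close>

lemma power_comparison:
  "\<exists>s>0. \<exists>K>0. \<forall>n. \<forall>B\<in>sets (F n).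
     (\<integral>\<^sup>+x\<in>B. ennreal (w x powr s) \<partial>\<nu>) \<le> ennreal K * (\<integral>\<^sup>+x\<in>B. ennreal (W n x powr s) \<partial>\<nu>)"
proof -
  \<comment> \<open>With this exponent the ratio \<open>L powr s * \<beta>\<close> of the series is \<open>sqrt \<beta>\<close>.\<close>
  define s where "s = - ln \<beta> / (2 * ln L)"
  define r where "r = L powr s"
  have lnL: "0 < ln L" using L by simp
  have s: "0 < s" using \<beta> lnL by (simp add: s_def divide_neg_pos)
  have r1: "1 < r" using L s by (simp add: r_def)
  have "r = exp (- (ln \<beta> / 2))" using L lnL by (simp add: r_def s_def powr_def)
  then have "r * \<beta> = exp (- (ln \<beta> / 2)) * exp (ln \<beta>)" using \<beta> by simp
  also have "\<dots> = exp (ln \<beta> / 2)" by (subst exp_add[symmetric]) simp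
  also have "\<dots> < 1" using \<beta> by simp
  finally have r\<beta>: "r * \<beta> < 1" .
  have Lr: "(L ^ k) powr s = r ^ k" for k
    using L by (simp add: r_def powr_power powr_powr powr_realpow[symmetric] mult.commute)
  define K where "K = 1 + r / (1 - r * \<beta>)"
  have series: "(\<lambda>k. r * (r * \<beta>) ^ k) sums (r / (1 - r * \<beta>))"
  proof -
    have "norm (r * \<beta>) < 1" using r\<beta> r1 \<beta> by simp
    from sums_mult[OF geometric_sums[OF this], of r] show ?thesis by simp
  qed
  have K: "0 < K" using r1 r\<beta> by (auto simp: K_def intro: add_pos_pos)
  have main: "(\<integral>\<^sup>+x\<in>B. ennreal (w x powr s) \<partial>\<nu>) \<le> ennreal K * (\<integral>\<^sup>+x\<in>B. ennreal (W n x powr s) \<partial>\<nu>)"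
    if B: "B \<in> sets (F n)" for n B
  proof -
    have [measurable]: "B \<in> sets \<mu>" by (rule sets_F_D[OF B])
    define h where "h x = ennreal (W n x powr s) * indicator B x" for x
    have hF: "h \<in> borel_measurable (F n)" unfolding h_def using B by measurable
    have [measurable]: "h \<in> borel_measurable \<mu>" by (rule measurable_from_subalg[OF subalg hF])
    have "AE x in \<mu>. \<forall>k. x \<notin> exceed n (L ^ k) \<longrightarrow> w x \<le> L ^ k * W n x"
      unfolding AE_all_countable using L by (auto intro: AE_le_off_exceed)
    then have "AE x in \<nu>. \<forall>k. x \<notin> exceed n (L ^ k) \<longrightarrow> w x \<le> L ^ k * W n x"
      by (rule AE_\<nu>)
    moreover have "AE x in \<nu>. 0 < w x"
      unfolding \<nu>_eq by (subst AE_density) auto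
    ultimately have ptw: "AE x in \<nu>. ennreal (w x powr s) * indicator B x
        \<le> h x + (\<Sum>k. ennreal (r * r ^ k) * (indicator (exceed n (L ^ k)) x * h x))"
      using AE_leaves_exceed[of n]
    proof eventually_elim
      case (elim x)
      have scale: "ennreal (w x powr s) * indicator B x \<le> ennreal (r ^ k) * h x"
        if "x \<notin> exceed n (L ^ k)" for k
      proof -
        have "w x powr s \<le> (L ^ k * W n x) powr s"
          using elim that s by (intro powr_mono2) auto
        also have "\<dots> = r ^ k * W n x powr s"
          using L W_pos[of n x] by (simp add: powr_mult Lr)
        finally show ?thesis
          using r1 by (auto simp: h_def indicator_def ennreal_mult[symmetric] intro!: ennreal_leI)
      qed
      let ?P = "\<lambda>k. x \<notin> exceed n (L ^ k)"
      \<comment> \<open>The first level \<open>L ^ k\<close> that is not exceeded; the previous one, if any, contributes a summand.\<close>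
      have "\<exists>k. ?P k" using elim by blast
      then have P: "?P (LEAST k. ?P k)" by (rule LeastI_ex)
      show ?case
      proof (cases "LEAST k. ?P k")
        case 0
        then show ?thesis using scale[OF P] by (simp add: add_increasing2)
      next
        case (Suc j)
        then have "x \<in> exceed n (L ^ j)" using not_less_Least[of j ?P] by auto
        then have "ennreal (w x powr s) * indicator B x
            \<le> (\<Sum>k\<in>{j}. ennreal (r * r ^ k) * (indicator (exceed n (L ^ k)) x * h x))"
          using scale[OF P] Suc by simp
        also have "\<dots> \<le> (\<Sum>k. ennreal (r * r ^ k) * (indicator (exceed n (L ^ k)) x * h x))"
          by (intro sum_le_suminf) auto
        finally show ?thesis by (simp add: add_increasing)
      qed
    qed
    have "(\<integral>\<^sup>+x\<in>B. ennreal (w x powr s) \<partial>\<nu>)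
        \<le> (\<integral>\<^sup>+x. h x + (\<Sum>k. ennreal (r * r ^ k) * (indicator (exceed n (L ^ k)) x * h x)) \<partial>\<nu>)"
      by (rule nn_integral_mono_AE[OF ptw])
    also have "\<dots> = (\<integral>\<^sup>+x. h x \<partial>\<nu>) + (\<Sum>k. ennreal (r * r ^ k) * (\<integral>\<^sup>+x. indicator (exceed n (L ^ k)) x * h x \<partial>\<nu>))"
      by (simp add: nn_integral_add nn_integral_suminf nn_integral_cmult)
    also have "\<dots> \<le> (\<integral>\<^sup>+x. h x \<partial>\<nu>) + (\<Sum>k. ennreal (r * r ^ k) * (ennreal (\<beta> ^ k) * (\<integral>\<^sup>+x. h x \<partial>\<nu>)))"
      by (intro add_left_mono suminf_le mult_left_mono
          nn_integral_le_if_emeasure_le[OF _ hF] emeasure_exceed_power) auto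
    also have "(\<lambda>k. ennreal (r * r ^ k) * (ennreal (\<beta> ^ k) * (\<integral>\<^sup>+x. h x \<partial>\<nu>)))
        = (\<lambda>k. ennreal (r * (r * \<beta>) ^ k) * (\<integral>\<^sup>+x. h x \<partial>\<nu>))"
    proof
      fix k
      have "ennreal (r * (r * \<beta>) ^ k) = ennreal (r * r ^ k) * ennreal (\<beta> ^ k)"
        using r1 \<beta> by (subst ennreal_mult[symmetric]) (auto simp: power_mult_distrib)
      then show "ennreal (r * r ^ k) * (ennreal (\<beta> ^ k) * (\<integral>\<^sup>+x. h x \<partial>\<nu>))
          = ennreal (r * (r * \<beta>) ^ k) * (\<integral>\<^sup>+x. h x \<partial>\<nu>)"
        by (simp only: mult.assoc)
    qed
    also have "(\<Sum>k. ennreal (r * (r * \<beta>) ^ k) * (\<integral>\<^sup>+x. h x \<partial>\<nu>))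
        = (\<Sum>k. ennreal (r * (r * \<beta>) ^ k)) * (\<integral>\<^sup>+x. h x \<partial>\<nu>)"
      by (rule ennreal_suminf_multc)
    also have "(\<Sum>k. ennreal (r * (r * \<beta>) ^ k)) = ennreal (r / (1 - r * \<beta>))"
      using r1 \<beta> by (intro suminf_ennreal_eq series) auto
    also have "(\<integral>\<^sup>+x. h x \<partial>\<nu>) + ennreal (r / (1 - r * \<beta>)) * (\<integral>\<^sup>+x. h x \<partial>\<nu>) = ennreal K * (\<integral>\<^sup>+x. h x \<partial>\<nu>)"
    proof -
      have "ennreal K = 1 + ennreal (r / (1 - r * \<beta>))"
        using r1 r\<beta> unfolding K_def by (subst ennreal_plus) auto
      then show ?thesis by (simp add: distrib_right)
    qed
    finally show ?thesis by (simp add: h_def)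
  qed
  with s K show ?thesis by blast
qed

end

section \<open>Weights and a single subalgebra\<close>

locale weight_subalgebra = prob_space M for M :: "'a measure" +
  fixes G :: "'a measure" and \<omega> :: "'a \<Rightarrow> real"
  assumes subalgebra_G: "subalgebra M G" and weight_\<omega>: "weight M \<omega>"
begin

sublocale finite_measure_subalgebra M G
  by unfold_locales (rule subalgebra_G)

lemma \<omega>_meas[measurable]: "\<omega> \<in> borel_measurable M"
  and \<omega>_pos: "AE x in M. 0 < \<omega> x"
  and \<omega>_integrable: "integrable M \<omega>"
  using weight_\<omega> by (auto simp: weight_def)

text \<open>
  A version of the conditional expectation of the weight with values in the positive reals; the
  value \<open>1\<close> is used on the null set where the conditional expectation is \<open>0\<close> or \<open>\<infinity>\<close>.
\<close>

definition W :: "'a \<Rightarrow> real" where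
  "W x = (if weight_cond M G \<omega> x = 0 \<or> weight_cond M G \<omega> x = top then 1
          else enn2real (weight_cond M G \<omega> x))"

lemma W_meas[measurable]: "W \<in> borel_measurable G"
proof -
  have [measurable]: "weight_cond M G \<omega> \<in> borel_measurable G" by (simp add: weight_cond_def)
  show ?thesis unfolding W_def[abs_def] by measurable
qed

lemma W_meas_M[measurable]: "W \<in> borel_measurable M"
  by (rule measurable_from_subalg[OF subalg W_meas])

lemma W_pos: "0 < W x"
  by (simp add: W_def enn2real_positive_iff less_top zero_less_iff_neq_zero)

lemma nn_integral_\<omega>_finite: "(\<integral>\<^sup>+x. ennreal (\<omega> x) \<partial>M) < \<infinity>"
proof -
  have "(\<integral>\<^sup>+x. ennreal (\<omega> x) \<partial>M) \<le> (\<integral>\<^sup>+x. ennreal (norm (\<omega> x)) \<partial>M)"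
    by (intro nn_integral_mono ennreal_leI) auto
  also have "\<dots> < \<infinity>" using \<omega>_integrable by (simp add: integrable_iff_bounded)
  finally show ?thesis .
qed

lemma AE_weight_cond: "AE x in M. weight_cond M G \<omega> x = ennreal (W x)"
proof -
  let ?E = "nn_cond_exp M G (\<lambda>x. ennreal (\<omega> x))"
  have "(\<integral>\<^sup>+x. ?E x \<partial>M) = (\<integral>\<^sup>+x. ennreal (\<omega> x) \<partial>M)"
    using nn_cond_exp_intg[of "\<lambda>_. 1" "\<lambda>x. ennreal (\<omega> x)"] by simp
  then have "AE x in M. ?E x \<noteq> \<infinity>"
    using nn_integral_\<omega>_finite by (intro nn_integral_noteq_infinite) auto
  moreover have "AE x in M. ?E x \<noteq> 0"
  proof -
    define Z where "Z = {x \<in> space G. ?E x = 0}"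
    have Z[measurable]: "Z \<in> sets G" unfolding Z_def by measurable
    have ZM[measurable]: "Z \<in> sets M" using Z subalg by (auto simp: subalgebra_def)
    have "(\<integral>\<^sup>+x. indicator Z x * ennreal (\<omega> x) \<partial>M) = (\<integral>\<^sup>+x. indicator Z x * ?E x \<partial>M)"
      by (rule nn_cond_exp_intg[symmetric]) auto
    also have "\<dots> = (\<integral>\<^sup>+x. 0 \<partial>M)"
      by (rule nn_integral_cong) (auto simp: Z_def indicator_def)
    finally have "(\<integral>\<^sup>+x. indicator Z x * ennreal (\<omega> x) \<partial>M) = 0" by simp
    then have "AE x in M. indicator Z x * ennreal (\<omega> x) = 0"
      by (subst (asm) nn_integral_0_iff_AE) auto
    with \<omega>_pos AE_space show ?thesis
    proof eventually_elim
      case (elim x)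
      then have "x \<notin> Z" by (auto simp: ennreal_eq_0_iff)
      then show ?case using elim subalg by (auto simp: Z_def subalgebra_def)
    qed
  qed
  ultimately show ?thesis
    by eventually_elim (auto simp: W_def weight_cond_def less_top)
qed

lemma AE_cond_exp_\<omega>: "AE x in M. nn_cond_exp M G (\<lambda>x. ennreal (\<omega> x)) x = ennreal (W x)"
  using AE_weight_cond by (simp add: weight_cond_def)

lemma AE_cond_exp_ln_finite: "AE x in M. nn_cond_exp M G (\<lambda>x. ennreal (ln (\<omega> x))) x < top"
proof -
  have "AE x in M. nn_cond_exp M G (\<lambda>x. ennreal (ln (\<omega> x))) x \<le> nn_cond_exp M G (\<lambda>x. ennreal (\<omega> x)) x"
    using \<omega>_pos
    by (intro nn_cond_exp_mono) (auto elim!: eventually_mono intro!: ennreal_leI less_imp_le[OF ln_less_self])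
  with AE_cond_exp_\<omega> show ?thesis
    by eventually_elim (auto simp: order_le_less_trans)
qed

text \<open>
  Conditional Jensen inequality for the exponential, via its tangent line. Let \<open>t = 1 / (p - 1)\<close>.
  The hypothesis reads \<open>E(\<omega> powr -t) \<le> exp d\<close> with \<open>d = t * ln (C / W)\<close>, and
  \<open>exp (-t * ln \<omega> - d) \<ge> 1 - t * ln \<omega> - d\<close> then yields \<open>E(ln \<omega>) \<ge> - d / t = ln (W / C)\<close>. The
  finiteness of \<open>E(ln\<^sup>- \<omega>)\<close> is part of what has to be proved, so the tangent inequality is arranged
  with nonnegative terms on both sides.
\<close>

lemma exp_bound_if_A_bound:
  assumes p: "1 < p" and C: "1 < C"
    and A: "AE x in M. weight_cond M G \<omega> x *
      powr_ennreal (nn_cond_exp M G (\<lambda>y. ennreal (\<omega> y powr (- 1 / (p - 1)))) x) (p - 1) \<le> ennreal C"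
  shows "AE x in M. weight_cond M G \<omega> x
    \<le> ennreal C * exp_ereal (ereal_cond_exp M G (\<lambda>y. ln (\<omega> y)) x)"
proof -
  define t where "t = 1 / (p - 1)"
  have t: "0 < t" and p_t: "p - 1 = 1 / t" and e_t: "- 1 / (p - 1) = - t"
    using p by (simp_all add: t_def)
  define d where "d x = t * ln (C / W x)" for x
  have d[measurable]: "d \<in> borel_measurable G" unfolding d_def[abs_def] by measurable
  let ?U = "nn_cond_exp M G (\<lambda>y. ennreal (\<omega> y powr - t))"
  let ?P = "nn_cond_exp M G (\<lambda>y. ennreal (ln (\<omega> y)))"
  let ?N = "nn_cond_exp M G (\<lambda>y. ennreal (- ln (\<omega> y)))"
  have "AE x in M. ennreal (1 + max 0 (- d x)) + ennreal t * ennreal (- ln (\<omega> x)) + 0 * 0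
      \<le> ennreal (max 0 (d x)) + ennreal (exp (- d x)) * ennreal (\<omega> x powr - t) + ennreal t * ennreal (ln (\<omega> x))"
    using \<omega>_pos
  proof eventually_elim
    case (elim x)
    have "1 + (- t * ln (\<omega> x) - d x) \<le> exp (- t * ln (\<omega> x) - d x)"
      by (rule exp_ge_add_one_self)
    also have "\<dots> = exp (- d x) * \<omega> x powr - t"
      using elim by (simp add: powr_def exp_add[symmetric])
    finally have "1 + max 0 (- d x) + t * max 0 (- ln (\<omega> x))
        \<le> max 0 (d x) + exp (- d x) * \<omega> x powr - t + t * max 0 (ln (\<omega> x))"
      using t by (auto simp: max_def)
    then have "ennreal (1 + max 0 (- d x) + t * max 0 (- ln (\<omega> x)))
        \<le> ennreal (max 0 (d x) + exp (- d x) * \<omega> x powr - t + t * max 0 (ln (\<omega> x)))"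
      by (rule ennreal_leI)
    then show ?case using t by (simp add: ennreal_plus ennreal_mult del: ennreal_plus[symmetric])
  qed
  then have "AE x in M. ennreal (1 + max 0 (- d x)) + ennreal t * ?N x + 0 * nn_cond_exp M G (\<lambda>_. 0) x
      \<le> ennreal (max 0 (d x)) + ennreal (exp (- d x)) * ?U x + ennreal t * ?P x"
    by (rule nn_cond_exp_affine_mono) auto
  then have "AE x in M. ennreal (1 + max 0 (- d x)) + ennreal t * ?N x
      \<le> ennreal (max 0 (d x)) + ennreal (exp (- d x)) * ?U x + ennreal t * ?P x"
    by simp
  with A AE_weight_cond AE_cond_exp_ln_finite show ?thesis
    unfolding e_t p_t
  proof eventually_elim
    case (elim x)
    have Wx: "0 < W x" by (rule W_pos)
    have "?U x \<noteq> top"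
      using elim(1,2) Wx by (auto simp: powr_ennreal_def ennreal_mult_top top_unique)
    then obtain u where u: "?U x = ennreal u" "0 \<le> u" by (cases "?U x") auto
    have "W x * u powr (1 / t) \<le> C"
      using elim(1,2) u Wx C by (simp add: powr_ennreal_def ennreal_mult[symmetric])
    then have "u powr (1 / t) \<le> C / W x" using Wx by (simp add: pos_le_divide_eq mult.commute)
    then have "(u powr (1 / t)) powr t \<le> (C / W x) powr t"
      using t by (intro powr_mono2) auto
    then have "u \<le> (C / W x) powr t" using u t by (simp add: powr_powr)
    also have "\<dots> = exp (d x)" using C Wx by (simp add: powr_def d_def)
    finally have eu: "exp (- d x) * u \<le> 1" by (simp add: exp_minus field_simps)
    obtain p' where p': "?P x = ennreal p'" "0 \<le> p'" using elim(3) by (cases "?P x") auto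
    have fin: "ennreal t * ?N x \<noteq> top"
    proof
      assume "ennreal t * ?N x = top"
      then have "top \<le> ennreal (max 0 (d x)) + ennreal (exp (- d x)) * ?U x + ennreal t * ?P x"
        using elim(4) by simp
      then show False using t by (simp add: u p' ennreal_mult[symmetric] top_unique)
    qed
    then have "?N x \<noteq> top" using t by (auto simp: ennreal_mult_top)
    then obtain m where m: "?N x = ennreal m" "0 \<le> m" by (cases "?N x") auto
    \<comment> \<open>Names for the two parts of \<open>d x\<close>, which simplification would otherwise replace by truncations.\<close>
    obtain a b where ab: "a = max 0 (- d x)" "b = max 0 (d x)" by blast
    then have ab0: "0 \<le> a" "0 \<le> b" "b - a = d x" by (simp_all add: max_def)
    have "1 + a + t * m \<le> b + exp (- d x) * u + t * p'"
      using elim(4)[folded ab] ab0 t u p' m by (simp add: ennreal_mult[symmetric] ennreal_plus[symmetric] del: ennreal_plus)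
    then have "t * m \<le> d x + t * p'" using eu ab0 by linarith
    then have "t * m \<le> t * (ln (C / W x) + p')" by (simp add: d_def distrib_left)
    then have "m \<le> ln (C / W x) + p'" using t by simp
    then have "ln (W x) \<le> ln C + (p' - m)" using C Wx by (simp add: ln_div)
    then have "exp (ln (W x)) \<le> exp (ln C + (p' - m))" by (simp only: exp_le_cancel_iff)
    then have "W x \<le> C * exp (p' - m)" using C Wx by (simp add: exp_add)
    then show ?case using C elim(2) p' m
      by (simp add: ereal_cond_exp_def exp_ereal_def ennreal_mult[symmetric] ennreal_leI enn2ereal_ennreal)
  qed
qed

text \<open>
  Since \<open>ln r \<le> r\<close> for all \<open>r > 0\<close>, and \<open>ln r \<le> ln \<gamma>\<close> for \<open>r \<le> \<gamma>\<close>, one has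
  \<open>ln (\<omega> / W) + ln (1 / \<gamma>) * indicator B \<le> \<omega> / W\<close> for \<open>B = {\<omega> \<le> \<gamma> * W}\<close>. Conditioning, and bounding
  \<open>E(ln (\<omega> / W))\<close> from below by \<open>- ln C\<close>, gives \<open>ln (1 / \<gamma>) * E(indicator B) \<le> 1 + ln C\<close>. The choice of \<open>\<gamma>\<close>
  makes \<open>ln (1 / \<gamma>)\<close> at least twice the right-hand side.
\<close>

lemma con_bound_if_exp_bound:
  assumes C: "0 < C"
    and E: "AE x in M. weight_cond M G \<omega> x \<le> ennreal C * exp_ereal (ereal_cond_exp M G (\<lambda>y. ln (\<omega> y)) x)"
  defines "\<gamma> \<equiv> exp (- (2 * (1 + \<bar>ln C\<bar>)))"
  shows "AE x in M. nn_cond_exp M G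
      (indicator {y \<in> space M. ennreal (\<omega> y) \<le> ennreal \<gamma> * weight_cond M G \<omega> y}) x \<le> ennreal (1 / 2)"
proof -
  define l where "l = 2 * (1 + \<bar>ln C\<bar>)"
  have l: "0 < l" by (simp add: l_def)
  have [measurable]: "weight_cond M G \<omega> \<in> borel_measurable M" by (simp add: weight_cond_def)
  define B where "B = {y \<in> space M. ennreal (\<omega> y) \<le> ennreal \<gamma> * weight_cond M G \<omega> y}"
  have [measurable]: "B \<in> sets M" unfolding B_def by measurable
  let ?P = "nn_cond_exp M G (\<lambda>y. ennreal (ln (\<omega> y)))"
  let ?N = "nn_cond_exp M G (\<lambda>y. ennreal (- ln (\<omega> y)))"
  let ?I = "nn_cond_exp M G (indicator B)"
  have "AE x in M. ennreal (max 0 (- ln (W x))) + 1 * ennreal (ln (\<omega> x)) + ennreal l * indicator B x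
      \<le> ennreal (max 0 (ln (W x))) + ennreal (1 / W x) * ennreal (\<omega> x) + 1 * ennreal (- ln (\<omega> x))"
    using \<omega>_pos AE_weight_cond
  proof eventually_elim
    case (elim x)
    have Wx: "0 < W x" by (rule W_pos)
    have r: "0 < \<omega> x / W x" using Wx elim by simp
    have "ln (\<omega> x / W x) + l * indicator B x \<le> \<omega> x / W x"
    proof (cases "x \<in> B")
      case True
      then have "\<omega> x \<le> \<gamma> * W x"
        using elim Wx by (simp add: B_def \<gamma>_def ennreal_mult[symmetric])
      then have "\<omega> x / W x \<le> exp (- l)" using Wx by (simp add: \<gamma>_def l_def pos_divide_le_eq)
      then have "ln (\<omega> x / W x) \<le> ln (exp (- l))" using r by (intro ln_mono) auto
      then show ?thesis using True r by simp
    qed (use ln_less_self[OF r] in simp)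
    then have "max 0 (- ln (W x)) + max 0 (ln (\<omega> x)) + l * indicator B x
        \<le> max 0 (ln (W x)) + 1 / W x * \<omega> x + max 0 (- ln (\<omega> x))"
    proof -
      have "max 0 y - max 0 (- y) = y" for y :: real by (simp add: max_def)
      from this[of "ln (W x)"] this[of "ln (\<omega> x)"]
      have "max 0 (ln (W x)) - max 0 (- ln (W x)) + ln (\<omega> x / W x) = max 0 (ln (\<omega> x)) - max 0 (- ln (\<omega> x))"
        using Wx elim(1) by (simp add: ln_div)
      with \<open>ln (\<omega> x / W x) + l * indicator B x \<le> \<omega> x / W x\<close> show ?thesis by simp
    qed
    then have "ennreal (max 0 (- ln (W x)) + max 0 (ln (\<omega> x)) + l * indicator B x)
        \<le> ennreal (max 0 (ln (W x)) + 1 / W x * \<omega> x + max 0 (- ln (\<omega> x)))"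
      by (rule ennreal_leI)
    moreover have "ennreal (l * indicator B x) = ennreal l * indicator B x"
      by (simp add: indicator_def)
    moreover have "ennreal (1 / W x) * ennreal (\<omega> x) = ennreal (\<omega> x / W x)"
      using Wx elim by (simp add: ennreal_mult[symmetric])
    ultimately show ?case using Wx elim l
      by (simp add: ennreal_plus ennreal_mult del: ennreal_plus[symmetric])
  qed
  then have "AE x in M. ennreal (max 0 (- ln (W x))) + 1 * ?P x + ennreal l * ?I x
      \<le> ennreal (max 0 (ln (W x))) + ennreal (1 / W x) * nn_cond_exp M G (\<lambda>x. ennreal (\<omega> x)) x + 1 * ?N x"
    by (rule nn_cond_exp_affine_mono) auto
  with E AE_cond_exp_\<omega> AE_weight_cond AE_cond_exp_ln_finite
  have "AE x in M. ?I x \<le> ennreal (1 / 2)"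
  proof eventually_elim
    case (elim x)
    have Wx: "0 < W x" by (rule W_pos)
    obtain p' where p': "?P x = ennreal p'" "0 \<le> p'" using elim(4) by (cases "?P x") auto
    have "?N x \<noteq> top"
      using elim(1,3) p' Wx by (auto simp: ereal_cond_exp_def exp_ereal_def enn2ereal_ennreal)
    then obtain m where m: "?N x = ennreal m" "0 \<le> m" by (cases "?N x") auto
    have "ennreal l * ?I x \<noteq> top"
    proof
      assume "ennreal l * ?I x = top"
      then have "top \<le> ennreal (max 0 (ln (W x))) + ennreal (1 / W x) * ennreal (W x) + ?N x"
        using elim(5) elim(2) by simp
      then show False using Wx by (simp add: m ennreal_mult[symmetric] top_unique)
    qed
    then have "?I x \<noteq> top" using l by (auto simp: ennreal_mult_top)
    then obtain e where e: "?I x = ennreal e" "0 \<le> e" by (cases "?I x") auto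
    have "W x \<le> C * exp (p' - m)"
      using elim(1,3) p' m C by (simp add: ereal_cond_exp_def exp_ereal_def ennreal_mult[symmetric] enn2ereal_ennreal)
    then have "ln (W x) \<le> ln (C * exp (p' - m))" using Wx by (intro ln_mono) auto
    then have 1: "ln (W x) \<le> ln C + (p' - m)" using C by (simp add: ln_mult)
    obtain a b where ab: "a = max 0 (- ln (W x))" "b = max 0 (ln (W x))" by blast
    then have ab0: "0 \<le> a" "0 \<le> b" "b - a = ln (W x)" by (simp_all add: max_def)
    have "a + p' + l * e \<le> b + 1 + m"
      using elim(5)[folded ab] elim(2) ab0 l p' m e Wx
      by (simp add: ennreal_mult[symmetric] ennreal_plus[symmetric] ennreal_1[symmetric] del: ennreal_plus ennreal_1)
    with 1 ab0 have "l * e \<le> 1 + \<bar>ln C\<bar>" by linarith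
    then have "l * e \<le> l * (1 / 2)" by (simp add: l_def)
    then have "e \<le> 1 / 2" using l by simp
    then show ?case unfolding e(1) by (rule ennreal_leI)
  qed
  then show ?thesis by (simp only: B_def)
qed

lemma AE_weighted_cond_exp:
  assumes [measurable]: "A \<in> sets M"
  shows "AE x in M. weighted_cond_exp M \<omega> G (indicator A) x =
    nn_cond_exp M G (\<lambda>y. indicator A y * ennreal (\<omega> y)) x / ennreal (W x)"
proof -
  have "AE x in M. weighted_cond_exp M \<omega> G (indicator A) x =
      nn_cond_exp M G (\<lambda>y. indicator A y * ennreal (\<omega> y)) x / weight_cond M G \<omega> x"
    by (rule weighted_cond_exp_eq) (auto intro: prob_space_axioms subalgebra_G weight_\<omega>)
  with AE_weight_cond show ?thesis by eventually_elim simp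
qed

lemma divide_W_le_iff: "0 \<le> b \<Longrightarrow> y / ennreal (W x) \<le> ennreal b \<longleftrightarrow> y \<le> ennreal (b * W x)"
proof (cases y)
  case top
  then show ?thesis using W_pos[of x] by (simp add: ennreal_top_divide top_unique)
next
  case (real r)
  assume "0 \<le> b"
  then show ?thesis using W_pos[of x] real
    by (simp add: divide_ennreal pos_divide_le_eq)
qed

text \<open>
  Where \<open>x\<close> lies neither in \<open>A\<close> nor in \<open>B = {\<omega> \<le> \<gamma> * W}\<close>, the weight exceeds \<open>\<gamma> * W\<close>. The set of these
  points has conditional probability at least \<open>1 - \<delta> - (1 - \<delta>) / 2\<close>, so the complement of \<open>A\<close>
  keeps at least the share \<open>\<gamma> * (1 - \<delta>) / 2\<close> of the weighted measure.
\<close>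

lemma weighted_bound_if_con_bound:
  assumes \<gamma>: "0 < \<gamma>" "\<gamma> < 1" and \<delta>: "0 < \<delta>" "\<delta> < 1"
    and con: "AE x in M. nn_cond_exp M G
      (indicator {y \<in> space M. ennreal (\<omega> y) \<le> ennreal \<gamma> * weight_cond M G \<omega> y}) x \<le> ennreal \<delta>"
    and A[measurable]: "A \<in> sets M"
    and small: "AE x in M. nn_cond_exp M G (indicator A) x \<le> ennreal ((1 - \<delta>) / 2)"
  shows "AE x in M. weighted_cond_exp M \<omega> G (indicator A) x \<le> ennreal (1 - \<gamma> * (1 - \<delta>) / 2)"
proof -
  have [measurable]: "weight_cond M G \<omega> \<in> borel_measurable M" by (simp add: weight_cond_def)
  define B where "B = {y \<in> space M. ennreal (\<omega> y) \<le> ennreal \<gamma> * weight_cond M G \<omega> y}"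
  have [measurable]: "B \<in> sets M" unfolding B_def by measurable
  let ?n = "nn_cond_exp M G (\<lambda>y. indicator A y * ennreal (\<omega> y))"
  let ?w = "nn_cond_exp M G (\<lambda>y. ennreal (\<omega> y))"
  let ?f = "\<lambda>y. indicator A y + indicator B y :: ennreal"
  have "AE x in M. ennreal (\<gamma> * W x) + 1 * (indicator A x * ennreal (\<omega> x)) + 0 * 0
      \<le> 0 + ennreal (\<gamma> * W x) * ?f x + 1 * ennreal (\<omega> x)"
    using \<omega>_pos AE_weight_cond AE_space
  proof eventually_elim
    case (elim x)
    have Wx: "0 < W x" by (rule W_pos)
    show ?case
    proof (cases "x \<in> A \<or> x \<in> B")
      case True
      then have "ennreal (\<gamma> * W x) * 1 \<le> ennreal (\<gamma> * W x) * ?f x"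
        by (intro mult_left_mono) (auto simp: indicator_def)
      moreover have "indicator A x * ennreal (\<omega> x) \<le> ennreal (\<omega> x)"
        by (simp add: indicator_def)
      ultimately show ?thesis by (simp add: add_mono)
    next
      case False
      then show ?thesis using elim \<gamma> Wx
        by (simp add: B_def not_le ennreal_mult[symmetric] ennreal_leI less_imp_le)
    qed
  qed
  then have "AE x in M. ennreal (\<gamma> * W x) + 1 * ?n x + 0 * nn_cond_exp M G (\<lambda>_. 0) x
      \<le> 0 + ennreal (\<gamma> * W x) * nn_cond_exp M G ?f x + 1 * ?w x"
    by (rule nn_cond_exp_affine_mono) auto
  moreover have "AE x in M. nn_cond_exp M G (indicator A) x + nn_cond_exp M G (indicator B) x = nn_cond_exp M G ?f x"
    by (rule nn_cond_exp_sum) auto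
  ultimately show ?thesis
    using con[folded B_def] small AE_cond_exp_\<omega> AE_weighted_cond_exp[OF A]
  proof eventually_elim
    case (elim x)
    have Wx: "0 < W x" by (rule W_pos)
    have "nn_cond_exp M G ?f x \<le> ennreal ((1 - \<delta>) / 2) + ennreal \<delta>"
      using elim(2-4) by (metis add_mono)
    also have "\<dots> = ennreal ((1 + \<delta>) / 2)"
      using \<delta> by (simp add: ennreal_plus[symmetric] field_simps del: ennreal_plus)
    finally have "ennreal (\<gamma> * W x) * nn_cond_exp M G ?f x \<le> ennreal (\<gamma> * W x) * ennreal ((1 + \<delta>) / 2)"
      by (rule mult_left_mono) simp
    then have "ennreal (\<gamma> * W x) + ?n x \<le> ennreal (\<gamma> * W x) * ennreal ((1 + \<delta>) / 2) + ennreal (W x)"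
      using elim(1,5) by (auto intro: order_trans add_mono)
    then have le: "ennreal (\<gamma> * W x) + ?n x \<le> ennreal (\<gamma> * W x * ((1 + \<delta>) / 2) + W x)"
      using \<gamma> \<delta> Wx by (simp add: ennreal_mult[symmetric] ennreal_plus[symmetric] del: ennreal_plus)
    then have "?n x \<noteq> top" by (auto simp: top_unique)
    then obtain n where n: "?n x = ennreal n" "0 \<le> n" by (cases "?n x") auto
    have "\<gamma> * W x + n \<le> \<gamma> * W x * ((1 + \<delta>) / 2) + W x"
      using le n \<gamma> \<delta> Wx by (simp add: ennreal_plus[symmetric] del: ennreal_plus)
    then have "n \<le> (1 - \<gamma> * (1 - \<delta>) / 2) * W x" by (simp add: field_simps)
    moreover have "\<gamma> * (1 - \<delta>) \<le> 1 * 1" using \<gamma> \<delta> by (intro mult_mono) auto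
    ultimately show ?case by (simp add: elim(6) divide_W_le_iff n ennreal_leI)
  qed
qed

text \<open>
  Conditional Hoelder inequality in the form of a truncation: for any threshold \<open>\<theta> > 0\<close> known at
  the given time, \<open>\<omega> \<le> \<theta> + \<theta> powr (1 - q) * \<omega> powr q\<close>. The threshold \<open>W * a powr (-1 / q)\<close>, where
  \<open>a\<close> is the conditional probability of \<open>A\<close>, balances the two terms.
\<close>

lemma CF_bound_if_RH_bound:
  assumes q: "1 < q" and C: "1 < C"
    and RH: "AE x in M. nn_cond_exp M G (\<lambda>y. ennreal (\<omega> y powr q)) x
      \<le> ennreal C * powr_ennreal (weight_cond M G \<omega> x) q"
    and A[measurable]: "A \<in> sets M"
  shows "AE x in M. weighted_cond_exp M \<omega> G (indicator A) x
      \<le> ennreal (1 + C) * powr_ennreal (nn_cond_exp M G (indicator A) x) (1 - 1 / q)"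
proof -
  let ?a = "nn_cond_exp M G (indicator A)"
  let ?n = "nn_cond_exp M G (\<lambda>y. indicator A y * ennreal (\<omega> y))"
  let ?u = "nn_cond_exp M G (\<lambda>y. ennreal (\<omega> y powr q))"
  \<comment> \<open>Where the conditional probability of \<open>A\<close> vanishes the threshold is \<open>\<infinity>\<close>; then \<open>\<infinity> * 0 = 0\<close> gives the bound.\<close>
  define \<theta> where "\<theta> x = W x * enn2real (?a x) powr (- 1 / q)" for x
  define \<theta>\<^sub>1 where "\<theta>\<^sub>1 x = (if ?a x = 0 then top else ennreal (\<theta> x))" for x
  define \<theta>\<^sub>2 where "\<theta>\<^sub>2 x = (if ?a x = 0 then 0 else ennreal (\<theta> x powr (1 - q)))" for x
  have [measurable]: "\<theta> \<in> borel_measurable G" unfolding \<theta>_def[abs_def] by measurable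
  have [measurable]: "\<theta>\<^sub>1 \<in> borel_measurable G" "\<theta>\<^sub>2 \<in> borel_measurable G"
    unfolding \<theta>\<^sub>1_def[abs_def] \<theta>\<^sub>2_def[abs_def] by measurable
  have "AE x in M. ?a x \<le> nn_cond_exp M G (\<lambda>_. 1) x"
    by (rule nn_cond_exp_mono) (auto simp: indicator_def)
  moreover have "AE x in M. 1 = nn_cond_exp M G (\<lambda>_. 1) x"
    by (rule nn_cond_exp_F_meas) auto
  ultimately have a1: "AE x in M. ?a x \<le> 1" by eventually_elim simp
  have "AE x in M. 0 + 1 * (indicator A x * ennreal (\<omega> x)) + 0 * 0
      \<le> 0 + \<theta>\<^sub>1 x * indicator A x + \<theta>\<^sub>2 x * ennreal (\<omega> x powr q)"
    using \<omega>_pos a1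
  proof eventually_elim
    case (elim x)
    show ?case
    proof (cases "x \<in> A \<and> ?a x \<noteq> 0")
      case True
      then have "0 < enn2real (?a x)"
        using elim(2) by (auto simp: enn2real_positive_iff zero_less_iff_neq_zero less_top[symmetric] top_unique)
      then have \<theta>: "0 < \<theta> x" using W_pos[of x] by (simp add: \<theta>_def)
      have "\<omega> x \<le> \<theta> x + \<theta> x powr (1 - q) * \<omega> x powr q"
      proof (cases "\<omega> x \<le> \<theta> x")
        case False
        have "\<omega> x = \<omega> x powr (1 - q) * \<omega> x powr q"
          using elim by (simp add: powr_add[symmetric])
        also have "\<dots> \<le> \<theta> x powr (1 - q) * \<omega> x powr q"
          using False \<theta> q by (intro mult_right_mono powr_mono2') auto
        finally show ?thesis using \<theta> by simp
      qed (simp add: add_increasing2)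
      then have "ennreal (\<omega> x) \<le> ennreal (\<theta> x + \<theta> x powr (1 - q) * \<omega> x powr q)" by (rule ennreal_leI)
      then show ?thesis using True \<theta>
        by (simp add: \<theta>\<^sub>1_def \<theta>\<^sub>2_def ennreal_mult[symmetric] ennreal_plus[symmetric] del: ennreal_plus)
    qed (auto simp: \<theta>\<^sub>1_def indicator_def)
  qed
  then have "AE x in M. 0 + 1 * ?n x + 0 * nn_cond_exp M G (\<lambda>_. 0) x \<le> 0 + \<theta>\<^sub>1 x * ?a x + \<theta>\<^sub>2 x * ?u x"
    by (rule nn_cond_exp_affine_mono) auto
  with a1 RH AE_weight_cond AE_weighted_cond_exp[OF A] show ?thesis
  proof eventually_elim
    case (elim x)
    show ?case
    proof (cases "?a x = 0")
      case True
      then have "?n x = 0" using elim(5) by (simp add: \<theta>\<^sub>1_def \<theta>\<^sub>2_def)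
      then show ?thesis by (simp add: elim(4))
    next
      case False
      have Wx: "0 < W x" by (rule W_pos)
      obtain a where a: "?a x = ennreal a" "0 < a"
        using elim(1) False by (cases "?a x") (auto simp: less_le top_unique)
      have \<theta>: "\<theta> x = W x * a powr (- 1 / q)" "0 < \<theta> x" using a Wx by (simp_all add: \<theta>_def)
      have "a powr (- 1 / q) * a = a powr (- 1 / q) * a powr 1" using a by simp
      also have "\<dots> = a powr (1 - 1 / q)" unfolding powr_add[symmetric] by simp
      finally have 1: "\<theta> x * a = W x * a powr (1 - 1 / q)" by (simp add: \<theta>)
      have "(a powr (- 1 / q)) powr (1 - q) = a powr (1 - 1 / q)"
      proof -
        have "- 1 / q * (1 - q) = 1 - 1 / q" using q by (simp add: field_simps)
        then show ?thesis by (simp only: powr_powr)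
      qed
      then have "\<theta> x powr (1 - q) = W x powr (1 - q) * a powr (1 - 1 / q)"
        using Wx by (simp add: \<theta> powr_mult)
      moreover have "W x powr (1 - q) * W x powr q = W x" using Wx by (simp add: powr_add[symmetric])
      ultimately have 2: "\<theta> x powr (1 - q) * (C * W x powr q) = C * W x * a powr (1 - 1 / q)"
          by (simp add: ac_simps)
      have "?n x \<le> \<theta>\<^sub>1 x * ?a x + \<theta>\<^sub>2 x * ?u x" using elim(5) by simp
      also have "\<dots> \<le> \<theta>\<^sub>1 x * ?a x + \<theta>\<^sub>2 x * (ennreal C * powr_ennreal (weight_cond M G \<omega> x) q)"
        by (intro add_left_mono mult_left_mono elim(2)) auto
      also have "\<dots> = ennreal (\<theta> x * a + \<theta> x powr (1 - q) * (C * W x powr q))"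
        using a C Wx \<theta>(2)
        by (simp add: \<theta>\<^sub>1_def \<theta>\<^sub>2_def elim(3) powr_ennreal_def ennreal_mult[symmetric] ennreal_plus[symmetric] del: ennreal_plus)
      also have "\<theta> x * a + \<theta> x powr (1 - q) * (C * W x powr q) = (1 + C) * a powr (1 - 1 / q) * W x"
        unfolding 1 2 by (simp add: algebra_simps)
      finally have "?n x / ennreal (W x) \<le> ennreal ((1 + C) * a powr (1 - 1 / q))"
        using C by (subst divide_W_le_iff) auto
      then show ?thesis using C a
        by (simp add: elim(4) powr_ennreal_def ennreal_mult[symmetric] del: ennreal_plus)
    qed
  qed
qed

lemma AE_density_iff: "(AE x in density M (\<lambda>x. ennreal (\<omega> x)). P x) \<longleftrightarrow> (AE x in M. P x)"
proof -
  have "(AE x in density M (\<lambda>x. ennreal (\<omega> x)). P x) \<longleftrightarrow> (AE x in M. 0 < ennreal (\<omega> x) \<longrightarrow> P x)"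
    by (rule AE_density) simp
  also have "\<dots> \<longleftrightarrow> (AE x in M. P x)"
    using \<omega>_pos by (intro iffI; elim AE_mp) auto
  finally show ?thesis .
qed

lemma finite_measure_density: "finite_measure (density M (\<lambda>x. ennreal (\<omega> x)))"
  by (rule finite_measureI) (use nn_integral_\<omega>_finite in \<open>simp add: emeasure_density cong: nn_integral_cong\<close>)

lemma finite_subalgebra_density: "finite_measure_subalgebra (density M (\<lambda>x. ennreal (\<omega> x))) G"
  using finite_measure_density subalgebra_G
  by (simp add: finite_measure_subalgebra_def finite_measure_subalgebra_axioms_def subalgebra_def)

end

lemma (in finite_measure_subalgebra) AE_cond_exp_complement:
  assumes [measurable]: "A \<in> sets M"
  shows "AE x in M. nn_cond_exp M F (indicator A) x + nn_cond_exp M F (indicator (space M - A)) x = 1"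
proof -
  have "AE x in M. nn_cond_exp M F (indicator A) x + nn_cond_exp M F (indicator (space M - A)) x
      = nn_cond_exp M F (\<lambda>x. indicator A x + indicator (space M - A) x) x"
    by (rule nn_cond_exp_sum) auto
  moreover have "AE x in M. nn_cond_exp M F (\<lambda>x. indicator A x + indicator (space M - A) x) x = nn_cond_exp M F (\<lambda>_. 1) x"
    by (rule nn_cond_exp_cong) (auto simp: indicator_def)
  moreover have "AE x in M. 1 = nn_cond_exp M F (\<lambda>_. 1) x"
    by (rule nn_cond_exp_F_meas) auto
  ultimately show ?thesis by eventually_elim simp
qed

context weight_subalgebra
begin

text \<open>
  If \<open>A\<close> carries at most half of the weighted measure, its complement carries at least half; the
  hypothesis for the complement then bounds the conditional probability of the complement away from \<open>0\<close>.
\<close>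

lemma bound_if_CF_bound:
  assumes \<epsilon>: "0 < \<epsilon>" and C: "1 < C" and A[measurable]: "A \<in> sets M"
    and CF: "AE x in M. weighted_cond_exp M \<omega> G (indicator (space M - A)) x
      \<le> ennreal C * powr_ennreal (nn_cond_exp M G (indicator (space M - A)) x) \<epsilon>"
    and small: "AE x in M. weighted_cond_exp M \<omega> G (indicator A) x \<le> ennreal (1 / 2)"
  shows "AE x in M. nn_cond_exp M G (indicator A) x \<le> ennreal (1 - (1 / (2 * C)) powr (1 / \<epsilon>))"
proof -
  interpret N: finite_measure_subalgebra "density M (\<lambda>x. ennreal (\<omega> x))" G
    by (rule finite_subalgebra_density)
  have "AE x in M. weighted_cond_exp M \<omega> G (indicator A) x + weighted_cond_exp M \<omega> G (indicator (space M - A)) x = 1"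
    using N.AE_cond_exp_complement[of A] by (simp add: AE_density_iff weighted_cond_exp_def)
  with CF small AE_cond_exp_complement[OF A] show ?thesis
  proof eventually_elim
    case (elim x)
    let ?a = "nn_cond_exp M G (indicator A) x" and ?b = "nn_cond_exp M G (indicator (space M - A)) x"
    let ?v = "weighted_cond_exp M \<omega> G (indicator A) x"
    let ?z = "weighted_cond_exp M \<omega> G (indicator (space M - A)) x"
    obtain a where a: "?a = ennreal a" "0 \<le> a" using elim(3) by (cases ?a) auto
    obtain b where b: "?b = ennreal b" "0 \<le> b" using elim(3) by (cases ?b) auto
    obtain v where v: "?v = ennreal v" "0 \<le> v" using elim(4) by (cases ?v) auto
    obtain z where z: "?z = ennreal z" "0 \<le> z" using elim(4) by (cases ?z) auto
    have ab: "a + b = 1" using elim(3) a b by (simp add: ennreal_plus[symmetric] ennreal_1[symmetric] del: ennreal_plus ennreal_1)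
    have vz: "v + z = 1" using elim(4) v z by (simp add: ennreal_plus[symmetric] ennreal_1[symmetric] del: ennreal_plus ennreal_1)
    have "v \<le> 1 / 2" using elim(2) v by (simp del: ennreal_half)
    moreover have "z \<le> C * b powr \<epsilon>"
      using elim(1) z b C by (simp add: powr_ennreal_def ennreal_mult[symmetric])
    ultimately have "1 / 2 \<le> C * b powr \<epsilon>" using vz by simp
    then have "1 / (2 * C) \<le> b powr \<epsilon>" using C by (simp add: field_simps)
    then have "(1 / (2 * C)) powr (1 / \<epsilon>) \<le> (b powr \<epsilon>) powr (1 / \<epsilon>)"
      using \<epsilon> C by (intro powr_mono2) auto
    then have "(1 / (2 * C)) powr (1 / \<epsilon>) \<le> b" using \<epsilon> b by (simp add: powr_powr)
    then show ?case using ab a by (simp add: ennreal_leI)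
  qed
qed

end

section \<open>Weights along the filtration\<close>

locale weight_filtration = prob_space M for M :: "'a measure" +
  fixes F :: "nat \<Rightarrow> 'a measure" and \<omega> :: "'a \<Rightarrow> real"
  assumes subalgebra_F: "\<And>n. subalgebra M (F n)"
    and sets_F_mono: "\<And>m n. m \<le> n \<Longrightarrow> sets (F m) \<subseteq> sets (F n)"
    and sets_generated: "sets M = sigma_sets (space M) (\<Union>n. sets (F n))"
    and weight: "weight M \<omega>"
begin

sublocale at: weight_subalgebra M "F n" \<omega> for n
  by unfold_locales (rule subalgebra_F weight)+

abbreviation W :: "nat \<Rightarrow> 'a \<Rightarrow> real" where "W n \<equiv> at.W n"

abbreviation N :: "'a measure" where "N \<equiv> density M (\<lambda>x. ennreal (\<omega> x))"

lemma AE_N_iff: "(AE x in N. P x) \<longleftrightarrow> (AE x in M. P x)"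
  by (rule at.AE_density_iff)

lemma nn_integral_N:
  assumes [measurable]: "f \<in> borel_measurable (F n)"
  shows "(\<integral>\<^sup>+x. f x \<partial>N) = (\<integral>\<^sup>+x. f x * ennreal (W n x) \<partial>M)"
proof -
  have [measurable]: "f \<in> borel_measurable M" by (rule measurable_from_subalg[OF subalgebra_F assms])
  have [measurable]: "\<omega> \<in> borel_measurable M" using weight by (simp add: weight_def)
  have "(\<integral>\<^sup>+x. f x \<partial>N) = (\<integral>\<^sup>+x. f x * ennreal (\<omega> x) \<partial>M)"
    by (simp add: nn_integral_density mult.commute)
  also have "\<dots> = (\<integral>\<^sup>+x. f x * nn_cond_exp M (F n) (\<lambda>x. ennreal (\<omega> x)) x \<partial>M)"
    by (rule at.nn_cond_exp_intg[symmetric]) auto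
  also have "\<dots> = (\<integral>\<^sup>+x. f x * ennreal (W n x) \<partial>M)"
    using at.AE_cond_exp_\<omega>[of n] by (intro nn_integral_cong_AE) (auto elim: eventually_mono)
  finally show ?thesis .
qed

lemma density_N_inverse: "density N (\<lambda>x. ennreal (1 / \<omega> x)) = M"
proof -
  have [measurable]: "\<omega> \<in> borel_measurable M" using weight by (simp add: weight_def)
  have "density N (\<lambda>x. ennreal (1 / \<omega> x)) = density M (\<lambda>x. ennreal (\<omega> x) * ennreal (1 / \<omega> x))"
    by (rule density_density_eq) auto
  also have "\<dots> = density M (\<lambda>_. 1)"
    using at.\<omega>_pos
    by (intro density_cong) (auto elim!: eventually_mono simp: ennreal_mult[symmetric] ennreal_1[symmetric] simp del: ennreal_1)
  finally show ?thesis by (simp add: density_1)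
qed

text \<open>
  The self-improvement for \<open>\<nu> = \<omega> d\<mu>\<close>. Since \<open>\<integral> \<omega> powr s d\<nu> = \<integral> \<omega> powr (s + 1) d\<mu>\<close>, and likewise for \<open>W n\<close>,
  its conclusion is a reverse Hoelder inequality with exponent \<open>q = s + 1\<close>.
\<close>

lemma RH_if_A_inf_M:
  assumes S: "regular_S M F \<omega>" and AM: "A_inf_M M F \<omega>"
  shows "\<exists>q>1. RH_class q M F \<omega>"
proof -
  obtain C where C: "1 < C" and CW: "\<And>n. 1 \<le> n \<Longrightarrow> AE x in M.
      weight_cond M (F n) \<omega> x \<le> ennreal C * weight_cond M (F (n - 1)) \<omega> x"
    using S unfolding regular_S_def AE_conj_iff by blast
  obtain \<alpha> \<beta> where \<alpha>: "0 < \<alpha>" and \<beta>: "0 < \<beta>" "\<beta> < 1"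
    and AM': "\<And>n A. A \<in> sets M \<Longrightarrow> AE x in M. nn_cond_exp M (F n) (indicator A) x \<le> ennreal \<alpha> \<Longrightarrow>
      AE x in M. weighted_cond_exp M \<omega> (F n) (indicator A) x \<le> ennreal \<beta>"
    using AM unfolding A_inf_M_def by blast
  have process: "small_sets_process M N F \<omega> W C \<alpha> \<beta> (max 2 (C / \<alpha>))"
  proof (intro small_sets_process.intro density_process.intro small_sets_process_axioms.intro)
    show "finite_measure M" by (rule finite_measure_axioms)
    show "finite_measure N" by (rule at.finite_measure_density)
    have growth: "AE x in M. weight_cond M (F (Suc n)) \<omega> x \<le> ennreal C * weight_cond M (F n) \<omega> x" for n
      using CW[of "Suc n"] by simp
    show "AE x in M. W (Suc n) x \<le> C * W n x" for n
      using at.AE_weight_cond[of n] at.AE_weight_cond[of "Suc n"] growth[of n]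
    proof eventually_elim
      case (elim x)
      then show ?case using C at.W_pos[of n x] by (simp add: ennreal_mult[symmetric] ennreal_le_iff)
    qed
    show "C \<le> \<alpha> * max 2 (C / \<alpha>)"
    proof -
      have "\<alpha> * (C / \<alpha>) \<le> \<alpha> * max 2 (C / \<alpha>)" using \<alpha> by (intro mult_left_mono) auto
      then show ?thesis using \<alpha> by simp
    qed
    fix n A B assume A: "A \<in> sets M" and B: "B \<in> sets (F n)"
      and le: "\<And>B. B \<in> sets (F n) \<Longrightarrow> emeasure M (A \<inter> B) \<le> ennreal \<alpha> * emeasure M B"
    interpret N: finite_measure_subalgebra N "F n" by (rule at.finite_subalgebra_density)
    have "AE x in M. weighted_cond_exp M \<omega> (F n) (indicator A) x \<le> ennreal \<beta>"
      using le by (intro AM' A) (simp add: at.AE_nn_cond_exp_indicator_le_iff A)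
    then have "AE x in N. nn_cond_exp N (F n) (indicator A) x \<le> ennreal \<beta>"
      by (simp add: AE_N_iff weighted_cond_exp_def)
    then show "emeasure N (A \<inter> B) \<le> ennreal \<beta> * emeasure N B"
      using A B by (simp add: N.AE_nn_cond_exp_indicator_le_iff)
  qed (use \<alpha> \<beta> C subalgebra_F sets_F_mono sets_generated at.W_pos nn_integral_N in auto)
  obtain s K where s: "0 < s" and K: "0 < K"
    and le: "\<And>n B. B \<in> sets (F n) \<Longrightarrow> (\<integral>\<^sup>+x\<in>B. ennreal (\<omega> x powr s) \<partial>N) \<le> ennreal K * (\<integral>\<^sup>+x\<in>B. ennreal (W n x powr s) \<partial>N)"
    using small_sets_process.power_comparison[OF process] by blast
  have "AE x in M. nn_cond_exp M (F n) (\<lambda>y. ennreal (\<omega> y powr (s + 1))) x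
      \<le> ennreal (max 2 K) * powr_ennreal (weight_cond M (F n) \<omega> x) (s + 1)" for n
  proof -
    have "AE x in M. nn_cond_exp M (F n) (\<lambda>y. ennreal (\<omega> y powr (s + 1))) x \<le> ennreal (K * W n x powr (s + 1))"
    proof (subst at.AE_nn_cond_exp_le_iff)
      show "\<forall>B\<in>sets (F n). (\<integral>\<^sup>+x\<in>B. ennreal (\<omega> x powr (s + 1)) \<partial>M) \<le> (\<integral>\<^sup>+x\<in>B. ennreal (K * W n x powr (s + 1)) \<partial>M)"
      proof
        fix B assume B: "B \<in> sets (F n)"
        then have [measurable]: "B \<in> sets M" using subalgebra_F[of n] unfolding subalgebra_def by blast
        have "(\<integral>\<^sup>+x\<in>B. ennreal (\<omega> x powr (s + 1)) \<partial>M) = (\<integral>\<^sup>+x. ennreal (\<omega> x) * (ennreal (\<omega> x powr s) * indicator B x) \<partial>M)"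
          using at.\<omega>_pos by (intro nn_integral_cong_AE)
            (auto elim!: eventually_mono simp: indicator_def ennreal_mult[symmetric] powr_add mult.commute)
        also have "\<dots> = (\<integral>\<^sup>+x\<in>B. ennreal (\<omega> x powr s) \<partial>N)"
          by (rule nn_integral_density[symmetric]) auto
        also have "\<dots> \<le> ennreal K * (\<integral>\<^sup>+x\<in>B. ennreal (W n x powr s) \<partial>N)" by (rule le[OF B])
        also have "\<dots> = ennreal K * (\<integral>\<^sup>+x. ennreal (W n x powr s) * indicator B x * ennreal (W n x) \<partial>M)"
          using B by (subst nn_integral_N[of _ n]) auto
        also have "\<dots> = (\<integral>\<^sup>+x. ennreal K * (ennreal (W n x powr s) * indicator B x * ennreal (W n x)) \<partial>M)"
          by (rule nn_integral_cmult[symmetric]) auto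
        also have "\<dots> = (\<integral>\<^sup>+x\<in>B. ennreal (K * W n x powr (s + 1)) \<partial>M)"
        proof (rule nn_integral_cong)
          fix x
          have "K * W n x powr (s + 1) = K * (W n x powr s * W n x)" using at.W_pos[of n x] by (simp add: powr_add)
          then show "ennreal K * (ennreal (W n x powr s) * indicator B x * ennreal (W n x))
              = ennreal (K * W n x powr (s + 1)) * indicator B x"
            using K at.W_pos[of n x] by (auto simp: indicator_def ennreal_mult less_imp_le)
        qed
        finally show "(\<integral>\<^sup>+x\<in>B. ennreal (\<omega> x powr (s + 1)) \<partial>M) \<le> (\<integral>\<^sup>+x\<in>B. ennreal (K * W n x powr (s + 1)) \<partial>M)" .
      qed
    qed auto
    with at.AE_weight_cond[of n] show ?thesis
    proof eventually_elim
      case (elim x)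
      have "ennreal (max 2 K) * powr_ennreal (weight_cond M (F n) \<omega> x) (s + 1) = ennreal (max 2 K * W n x powr (s + 1))"
        unfolding elim(1) using at.W_pos[of n x]
        by (subst ennreal_mult) (auto simp: powr_ennreal_def)
      moreover have "ennreal (K * W n x powr (s + 1)) \<le> ennreal (max 2 K * W n x powr (s + 1))"
        by (intro ennreal_leI mult_right_mono) auto
      ultimately show ?case using order_trans[OF elim(2)] by presburger
    qed
  qed
  then have "RH_class (s + 1) M F \<omega>"
    unfolding RH_class_def by (intro exI[of _ "max 2 K"]) auto
  with s show ?thesis by (intro exI[of _ "s + 1"]) auto
qed

text \<open>
  The self-improvement with the roles of \<open>\<mu>\<close> and \<open>\<omega> d\<mu>\<close> exchanged: relative to \<open>\<omega> d\<mu>\<close>, the measure \<open>\<mu>\<close> has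
  density \<open>1 / \<omega>\<close> and density process \<open>1 / W n\<close>, whose growth is controlled by the lower bound in the
  regularity condition. The conclusion \<open>E(\<omega> powr -s) \<le> K * W n powr -s\<close> is the \<open>A_p\<close>
  condition for \<open>p = 1 + 1 / s\<close>.
\<close>

lemma A_class_if_A_inf_M_hat:
  assumes S: "regular_S M F \<omega>" and AM: "A_inf_M_hat M F \<omega>"
  shows "\<exists>p>1. A_class p M F \<omega>"
proof -
  obtain C where C: "1 < C" and CW: "\<And>n. 1 \<le> n \<Longrightarrow> AE x in M.
      ennreal (1 / C) * weight_cond M (F (n - 1)) \<omega> x \<le> weight_cond M (F n) \<omega> x"
    using S unfolding regular_S_def AE_conj_iff by blast
  obtain \<alpha> \<beta> where \<alpha>: "0 < \<alpha>" and \<beta>: "0 < \<beta>" "\<beta> < 1"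
    and AM': "\<And>n A. A \<in> sets M \<Longrightarrow> AE x in M. weighted_cond_exp M \<omega> (F n) (indicator A) x \<le> ennreal \<alpha> \<Longrightarrow>
      AE x in M. nn_cond_exp M (F n) (indicator A) x \<le> ennreal \<beta>"
    using AM unfolding A_inf_M_hat_def by blast
  have process: "small_sets_process N M F (\<lambda>x. 1 / \<omega> x) (\<lambda>n x. 1 / W n x) C \<alpha> \<beta> (max 2 (C / \<alpha>))"
  proof (intro small_sets_process.intro density_process.intro small_sets_process_axioms.intro)
    show "finite_measure M" by (rule finite_measure_axioms)
    show "finite_measure N" by (rule at.finite_measure_density)
    show "M = density N (\<lambda>x. ennreal (1 / \<omega> x))" by (rule density_N_inverse[symmetric])
    have decay: "AE x in M. ennreal (1 / C) * weight_cond M (F n) \<omega> x \<le> weight_cond M (F (Suc n)) \<omega> x" for n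
      using CW[of "Suc n"] by simp
    have "AE x in M. 1 / W (Suc n) x \<le> C * (1 / W n x)" for n
      using decay[of n] at.AE_weight_cond[of n] at.AE_weight_cond[of "Suc n"]
    proof eventually_elim
      case (elim x)
      then show ?case using C at.W_pos[of n x] at.W_pos[of "Suc n" x]
        by (simp add: ennreal_mult[symmetric] ennreal_le_iff field_simps)
    qed
    then show "AE x in N. 1 / W (Suc n) x \<le> C * (1 / W n x)" for n by (simp only: AE_N_iff)
    show "(\<integral>\<^sup>+x. f x \<partial>M) = (\<integral>\<^sup>+x. f x * ennreal (1 / W n x) \<partial>N)"
      if [measurable]: "f \<in> borel_measurable (F n)" for n and f :: "'a \<Rightarrow> ennreal"
    proof -
      have "(\<integral>\<^sup>+x. f x * ennreal (1 / W n x) \<partial>N) = (\<integral>\<^sup>+x. f x * ennreal (1 / W n x) * ennreal (W n x) \<partial>M)"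
        by (rule nn_integral_N) measurable
      also have "\<dots> = (\<integral>\<^sup>+x. f x \<partial>M)"
      proof (rule nn_integral_cong)
        fix x
        have "ennreal (1 / W n x) * ennreal (W n x) = 1"
          using at.W_pos[of n x] by (simp add: ennreal_mult[symmetric] ennreal_1[symmetric] del: ennreal_1)
        then show "f x * ennreal (1 / W n x) * ennreal (W n x) = f x" by (simp add: mult.assoc)
      qed
      finally show ?thesis by simp
    qed
    show "C \<le> \<alpha> * max 2 (C / \<alpha>)"
    proof -
      have "\<alpha> * (C / \<alpha>) \<le> \<alpha> * max 2 (C / \<alpha>)" using \<alpha> by (intro mult_left_mono) auto
      then show ?thesis using \<alpha> by simp
    qed
    show "subalgebra N (F n)" for n using subalgebra_F[of n] by (simp add: subalgebra_def)
    fix n A B assume "A \<in> sets N" and B: "B \<in> sets (F n)"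
      and le: "\<And>B. B \<in> sets (F n) \<Longrightarrow> emeasure N (A \<inter> B) \<le> ennreal \<alpha> * emeasure N B"
    then have A: "A \<in> sets M" by simp
    interpret N: finite_measure_subalgebra N "F n" by (rule at.finite_subalgebra_density)
    have "AE x in N. nn_cond_exp N (F n) (indicator A) x \<le> ennreal \<alpha>"
      using A le by (simp add: N.AE_nn_cond_exp_indicator_le_iff)
    then have "AE x in M. nn_cond_exp M (F n) (indicator A) x \<le> ennreal \<beta>"
      by (intro AM' A) (simp add: AE_N_iff weighted_cond_exp_def)
    then show "emeasure M (A \<inter> B) \<le> ennreal \<beta> * emeasure M B"
      using A B by (simp add: at.AE_nn_cond_exp_indicator_le_iff)
  qed (use \<alpha> \<beta> C sets_F_mono sets_generated at.W_pos in auto)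
  obtain s K where s: "0 < s" and K: "0 < K"
    and le: "\<And>n B. B \<in> sets (F n) \<Longrightarrow> (\<integral>\<^sup>+x\<in>B. ennreal ((1 / \<omega> x) powr s) \<partial>M)
      \<le> ennreal K * (\<integral>\<^sup>+x\<in>B. ennreal ((1 / W n x) powr s) \<partial>M)"
    using small_sets_process.power_comparison[OF process] by blast
  have inv: "(1 / y) powr s = y powr - s" if "0 < y" for y :: real
    using that by (simp add: powr_minus powr_divide inverse_eq_divide)
  have "AE x in M. weight_cond M (F n) \<omega> x *
      powr_ennreal (nn_cond_exp M (F n) (\<lambda>y. ennreal (\<omega> y powr (- 1 / (1 + 1 / s - 1)))) x) (1 + 1 / s - 1)
      \<le> ennreal (max 2 (K powr (1 / s)))" for n
  proof -
    have "AE x in M. nn_cond_exp M (F n) (\<lambda>y. ennreal (\<omega> y powr - s)) x \<le> ennreal (K * W n x powr - s)"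
    proof (subst at.AE_nn_cond_exp_le_iff)
      show "\<forall>B\<in>sets (F n). (\<integral>\<^sup>+x\<in>B. ennreal (\<omega> x powr - s) \<partial>M) \<le> (\<integral>\<^sup>+x\<in>B. ennreal (K * W n x powr - s) \<partial>M)"
      proof
        fix B assume B: "B \<in> sets (F n)"
        then have [measurable]: "B \<in> sets M" using subalgebra_F[of n] unfolding subalgebra_def by blast
        have "(\<integral>\<^sup>+x\<in>B. ennreal (\<omega> x powr - s) \<partial>M) = (\<integral>\<^sup>+x\<in>B. ennreal ((1 / \<omega> x) powr s) \<partial>M)"
          by (intro nn_integral_cong_AE eventually_mono[OF at.\<omega>_pos]) (simp add: inv)
        also have "\<dots> \<le> ennreal K * (\<integral>\<^sup>+x\<in>B. ennreal ((1 / W n x) powr s) \<partial>M)" by (rule le[OF B])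
        also have "\<dots> = (\<integral>\<^sup>+x. ennreal K * (ennreal ((1 / W n x) powr s) * indicator B x) \<partial>M)"
          by (rule nn_integral_cmult[symmetric]) measurable
        also have "\<dots> = (\<integral>\<^sup>+x\<in>B. ennreal (K * W n x powr - s) \<partial>M)"
        proof (rule nn_integral_cong)
          fix x
          have "ennreal (K * W n x powr - s) = ennreal K * ennreal ((1 / W n x) powr s)"
            using K by (subst ennreal_mult[symmetric]) (auto simp: inv at.W_pos)
          then show "ennreal K * (ennreal ((1 / W n x) powr s) * indicator B x)
              = ennreal (K * W n x powr - s) * indicator B x"
            by (simp only: mult.assoc)
        qed
        finally show "(\<integral>\<^sup>+x\<in>B. ennreal (\<omega> x powr - s) \<partial>M) \<le> (\<integral>\<^sup>+x\<in>B. ennreal (K * W n x powr - s) \<partial>M)" .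
      qed
    qed auto
    with at.AE_weight_cond[of n] show ?thesis
    proof eventually_elim
      case (elim x)
      let ?u = "nn_cond_exp M (F n) (\<lambda>y. ennreal (\<omega> y powr - s)) x"
      have Wx: "0 < W n x" by (rule at.W_pos)
      obtain u where u: "?u = ennreal u" "0 \<le> u" "u \<le> K * W n x powr - s"
        using elim(2) K by (cases ?u) (auto simp: top_unique)
      have "u powr (1 / s) \<le> (K * W n x powr - s) powr (1 / s)"
        using u s by (intro powr_mono2) auto
      also have "\<dots> = K powr (1 / s) / W n x"
      proof -
        have "(W n x powr - s) powr (1 / s) = W n x powr - 1" using s by (simp add: powr_powr)
        then show ?thesis using K Wx by (simp add: powr_mult powr_minus divide_inverse)
      qed
      finally have "W n x * u powr (1 / s) \<le> K powr (1 / s)" using Wx by (simp add: field_simps)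
      then have "ennreal (W n x * u powr (1 / s)) \<le> ennreal (max 2 (K powr (1 / s)))"
        by (intro ennreal_leI) auto
      then show ?case using u Wx s
        by (simp add: elim(1) powr_ennreal_def ennreal_mult)
    qed
  qed
  then have "A_class (1 + 1 / s) M F \<omega>"
    unfolding A_class_def by (intro exI[of _ "max 2 (K powr (1 / s))"]) auto
  with s show ?thesis by (intro exI[of _ "1 + 1 / s"]) auto
qed

lemma A_inf_exp_if_A_class:
  assumes p: "1 < p" and "A_class p M F \<omega>"
  shows "A_inf_exp M F \<omega>"
proof -
  obtain C where C: "1 < C" and A: "\<And>n. AE x in M. weight_cond M (F n) \<omega> x *
      powr_ennreal (nn_cond_exp M (F n) (\<lambda>y. ennreal (\<omega> y powr (- 1 / (p - 1)))) x) (p - 1) \<le> ennreal C"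
    using assms unfolding A_class_def by blast
  show ?thesis
    unfolding A_inf_exp_def using at.exp_bound_if_A_bound[OF p C A] less_trans[OF zero_less_one C]
    by blast
qed

lemma A_inf_con_if_A_inf_exp:
  assumes "A_inf_exp M F \<omega>"
  shows "A_inf_con M F \<omega>"
proof -
  obtain C where C: "0 < C" and E: "\<And>n. AE x in M. weight_cond M (F n) \<omega> x
      \<le> ennreal C * exp_ereal (ereal_cond_exp M (F n) (\<lambda>y. ln (\<omega> y)) x)"
    using assms unfolding A_inf_exp_def by blast
  show ?thesis
    unfolding A_inf_con_def using at.con_bound_if_exp_bound[OF C E]
    by (intro exI[of _ "exp (- (2 * (1 + \<bar>ln C\<bar>)))"] exI[of _ "1 / 2"]) (simp del: ennreal_half)
qed

lemma A_inf_M_if_A_inf_con: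
  assumes "A_inf_con M F \<omega>"
  shows "A_inf_M M F \<omega>"
proof -
  obtain \<gamma> \<delta> where g: "0 < \<gamma>" "\<gamma> < 1" and d: "0 < \<delta>" "\<delta> < 1"
    and con: "\<And>n. AE x in M. nn_cond_exp M (F n)
      (indicator {y \<in> space M. ennreal (\<omega> y) \<le> ennreal \<gamma> * weight_cond M (F n) \<omega> y}) x \<le> ennreal \<delta>"
    using assms unfolding A_inf_con_def by blast
  have "\<gamma> * (1 - \<delta>) < 1 * 1" using g d by (intro mult_strict_mono) auto
  moreover have "0 < \<gamma> * (1 - \<delta>)" using g d by simp
  ultimately show ?thesis
    unfolding A_inf_M_def using at.weighted_bound_if_con_bound[OF g d con] d
    by (intro exI[of _ "(1 - \<delta>) / 2"] exI[of _ "1 - \<gamma> * (1 - \<delta>) / 2"]) auto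
qed

lemma A_inf_CF_if_RH_class:
  assumes q: "1 < q" and "RH_class q M F \<omega>"
  shows "A_inf_CF M F \<omega>"
proof -
  obtain C where C: "1 < C" and RH: "\<And>n. AE x in M. nn_cond_exp M (F n) (\<lambda>y. ennreal (\<omega> y powr q)) x
      \<le> ennreal C * powr_ennreal (weight_cond M (F n) \<omega> x) q"
    using assms unfolding RH_class_def by blast
  show ?thesis
    unfolding A_inf_CF_def using at.CF_bound_if_RH_bound[OF q C RH] q C
    by (intro exI[of _ "1 - 1 / q"] exI[of _ "1 + C"]) auto
qed

lemma A_inf_M_hat_if_A_inf_CF:
  assumes "A_inf_CF M F \<omega>"
  shows "A_inf_M_hat M F \<omega>"
proof -
  obtain \<epsilon> C where e: "0 < \<epsilon>" and C: "1 < C"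
    and CF: "\<And>n A. A \<in> sets M \<Longrightarrow> AE x in M. weighted_cond_exp M \<omega> (F n) (indicator A) x
           \<le> ennreal C * powr_ennreal (nn_cond_exp M (F n) (indicator A) x) \<epsilon>"
    using assms unfolding A_inf_CF_def by blast
  define \<kappa> where "\<kappa> = (1 / (2 * C)) powr (1 / \<epsilon>)"
  have "\<kappa> < 1 powr (1 / \<epsilon>)" unfolding \<kappa>_def using e C by (intro powr_less_mono2) auto
  then have \<kappa>: "0 < \<kappa>" "\<kappa> < 1" using C by (simp_all add: \<kappa>_def)
  have "AE x in M. nn_cond_exp M (F n) (indicator A) x \<le> ennreal (1 - \<kappa>)"
    if "A \<in> sets M" "AE x in M. weighted_cond_exp M \<omega> (F n) (indicator A) x \<le> ennreal (1 / 2)" for n A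
    unfolding \<kappa>_def using that by (intro at.bound_if_CF_bound e C CF) auto
  then show ?thesis
    unfolding A_inf_M_hat_def using \<kappa>
    by (intro exI[of _ "1 / 2"] exI[of _ "1 - \<kappa>"]) (simp del: ennreal_half)
qed

end

section \<open>Equivalence of the conditions\<close>

theorem theorem1p1:
  fixes M :: "'a measure" and F :: "nat \<Rightarrow> 'a measure" and \<omega> :: "'a \<Rightarrow> real"
  assumes "prob_space M" and "complete_measure M"
    and "filtration (space M) F"
    and "\<And>n. subalgebra M (F n)"
    and "sets M = sigma_sets (space M) (\<Union>n. sets (F n))"
    and "weight M \<omega>"
    and "regular_S M F \<omega>"
  shows "((\<exists>p>1. A_class p M F \<omega>) \<longleftrightarrow> A_inf_exp M F \<omega>) \<and>
         (A_inf_exp M F \<omega> \<longleftrightarrow> A_inf_con M F \<omega>) \<and>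
         (A_inf_con M F \<omega> \<longleftrightarrow> A_inf_M M F \<omega>) \<and>
         (A_inf_M M F \<omega> \<longleftrightarrow> (\<exists>q>1. RH_class q M F \<omega>)) \<and>
         ((\<exists>q>1. RH_class q M F \<omega>) \<longleftrightarrow> A_inf_CF M F \<omega>) \<and>
         (A_inf_CF M F \<omega> \<longleftrightarrow> A_inf_M_hat M F \<omega>)"
proof -
  interpret weight_filtration M F \<omega>
    using assms(1,4-6) filtration.sets_F_mono[OF assms(3)]
    by (simp add: weight_filtration_def weight_filtration_axioms_def)
  have "(\<exists>p>1. A_class p M F \<omega>) \<longrightarrow> A_inf_exp M F \<omega>"
    using A_inf_exp_if_A_class by blast
  moreover have "A_inf_exp M F \<omega> \<longrightarrow> A_inf_con M F \<omega>"
    using A_inf_con_if_A_inf_exp by blast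
  moreover have "A_inf_con M F \<omega> \<longrightarrow> A_inf_M M F \<omega>"
    using A_inf_M_if_A_inf_con by blast
  moreover have "A_inf_M M F \<omega> \<longrightarrow> (\<exists>q>1. RH_class q M F \<omega>)"
    using RH_if_A_inf_M[OF assms(7)] by blast
  moreover have "(\<exists>q>1. RH_class q M F \<omega>) \<longrightarrow> A_inf_CF M F \<omega>"
    using A_inf_CF_if_RH_class by blast
  moreover have "A_inf_CF M F \<omega> \<longrightarrow> A_inf_M_hat M F \<omega>"
    using A_inf_M_hat_if_A_inf_CF by blast
  moreover have "A_inf_M_hat M F \<omega> \<longrightarrow> (\<exists>p>1. A_class p M F \<omega>)"
    using A_class_if_A_inf_M_hat[OF assms(7)] by blast
  ultimately show ?thesis by argo
qed

end
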